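(* Let $\mathcal F$ be a class of Borel measurable real functions on a topological space $S$ with finite envelope $F$, and for given $\mu,\nu\in\mathcal P(S)$, let $\mathcal P_{0,\mu},\mathcal P_{0,\nu}$ be subsets of $\mathcal P(S)$ containing $\mu,\nu$, respectively, such that $\int F\,d\rho<\infty$ for all $\rho\in\mathcal P_{0,\mu}\cup\mathcal P_{0,\nu}$. Let $\mathcal P_{0,\mu}\otimes\mathcal P_{0,\nu}=\{\rho_1\otimes\rho_2:\rho_1\in\mathcal P_{0,\mu},\rho_2\in\mathcal P_{0,\nu}\}$. Let $\dot{\mathcal P}_{0,\mu}$ (resp. $\dot{\mathcal P}_{0,\nu}$) be the set of bounded measurable functions $h:S\to\mathbb R$ with $\mu$-mean (resp. $\nu$-mean) zero, and $\dot{\mathcal P}_{0,\mu}\oplus\dot{\mathcal P}_{0,\nu}=\{h_1\oplus h_2:h_1\in\dot{\mathcal P}_{0,\mu},h_2\in\dot{\mathcal P}_{0,\nu}\}$. Consider estimating $\delta:\mathcal P_{0,\mu}\otimes\mathcal P_{0,\nu}\to\mathbb R$ at $\mu\otimes\nu$ from i.i.d. data $(X_1,Y_1),\dots,(X_n,Y_n)\sim\mu\otimes\nu$. Suppose that (a) $\mathcal F$ is pre-Gaussian with respect to $\mu$ and $\nu$; (b) for every $h_1\oplus h_2\in\dot{\mathcal P}_{0,\mu}\oplus\dot{\mathcal P}_{0,\nu}$, $((1+th_1)\mu)\otimes((1+th_2)\nu)\in\mathcal P_{0,\mu}\otimes\mathcal P_{0,\nu}$ for sufficiently small $t>0$; (c)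 there exist continuous linear functionals $\delta'_\mu:\ell^\infty(\mathcal F)\to\mathbb R$ and $\delta'_\nu:\ell^\infty(\mathcal F)\to\mathbb R$ such that $$t^{-1}\{\delta(((1+th_1)\mu)\otimes((1+th_2)\nu))-\delta(\mu\otimes\nu)\}\to\delta'_\mu(h_1\mu)+\delta'_\nu(h_2\nu)\quad\text{as }t\downarrow0$$ for every $h_1\oplus h_2\in\dot{\mathcal P}_{0,\mu}\oplus\dot{\mathcal P}_{0,\nu}$. Then the semiparametric efficiency bound for estimating $\delta$ at $\mu\otimes\nu$ relative to the tangent space $\dot{\mathcal P}_{0,\mu}\oplus\dot{\mathcal P}_{0,\nu}$ agrees with $\mathrm{Var}(\delta'_\mu(G_\mu))+\mathrm{Var}(\delta'_\nu(G_\nu))$, where $G_\mu$ and $G_\nu$ are tight $\mu$- and $\nu$-Brownian bridges in $\ell^\infty(\mathcal F)$, respectively.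
   Context: $\mathcal P(S)$ is the set of Borel probability measures on $S$; $h\mu$ denotes the signed measure $h\,d\mu$; $(h_1\oplus h_2)(x,y)=h_1(x)+h_2(y)$. An envelope of $\mathcal F$ is a measurable $F\ge0$ with $|f|\le F$ for all $f\in\mathcal F$. $\ell^\infty(\mathcal F)$ is the space of bounded real functions on $\mathcal F$ with the sup-norm; a finite signed measure $\gamma$ is identified with $f\mapsto\int f\,d\gamma$. $\mathcal F$ is $\mu$-pre-Gaussian if there is a tight mean-zero Gaussian process $G_\mu$ in $\ell^\infty(\mathcal F)$ with $\mathrm{Cov}(G_\mu(f),G_\mu(g))=\mathrm{Cov}_\mu(f,g)$; such $G_\mu$ is called a tight $\mu$-Brownian bridge. Semiparametric efficiency bound. Consider a functional $\kappa:\mathcal P\to\mathbb R$ on a set of probability measures and $Q\in\mathcal P$. A submodel $\{Q_t:0\le t<\epsilon'\}\subset\mathcal P$ with $Q_0=Q$ has score function $h$ if $\int[t^{-1}(dQ_t^{1/2}-dQ^{1/2})-\tfrac12h\,dQ^{1/2}]^2\to0$ as $t\downarrow0$. A tangent set $\dot{\mathcal P}_Q$ is the set of scores of a collection of such submodels (tangent space if it is a vector subspace of $L^2(Q)$). $\kappa$ is differentiable at $Q$ relative to it if there is a continuous linear functional $\dot\kappa_Q:L^2(Q)\to\mathbb R$ with $t^{-1}(\kappa(Q_t)-\kappa(Q))\to\dot\kappa_Qh$ for every $h\in\dot{\mathcal P}_Q$ and submodel in the collection with score $h$. The bound is $\sup_{h\in\mathrm{lin}(\dot{\mathcal P}_Q),h\neq0}(\dot\kappa_Qh)^2/\|h\|^2_{L^2(Q)}$.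 Here $Q=\mu\otimes\nu$ and the tangent space $\dot{\mathcal P}_{0,\mu}\oplus\dot{\mathcal P}_{0,\nu}$ corresponds to the submodels $((1+th_1)\mu)\otimes((1+th_2)\nu)$. *)

theory Defs
  imports "HOL-Analysis.Analysis" "HOL-Probability.Probability"
begin

section \<open>The space of bounded functions on a function class\<close>

text \<open>Elements of \<^term>\<open>linf F\<close> are the bounded real functions on the index set \<open>F\<close>, extended by
  \<^term>\<open>undefined\<close> outside \<open>F\<close> (so that equality is equality on \<open>F\<close>), with the sup-distance.\<close>

abbreviation linf :: "'i set \<Rightarrow> ('i \<Rightarrow> real) metric" where
  "linf F \<equiv> funspace F euclidean_metric"

definition linf_borel :: "'i set \<Rightarrow> ('i \<Rightarrow> real) measure" where
  "linf_borel F = sigma (mspace (linf F)) {U. openin (mtopology_of (linf F)) U}"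

definition linf_dual :: "'i set \<Rightarrow> (('i \<Rightarrow> real) \<Rightarrow> real) \<Rightarrow> bool" where
  "linf_dual F \<phi> \<longleftrightarrow>
     continuous_map (mtopology_of (linf F)) euclideanreal \<phi> \<and>
     (\<forall>u\<in>mspace (linf F). \<forall>v\<in>mspace (linf F). \<forall>a b.
        \<phi> (\<lambda>f\<in>F. a * u f + b * v f) = a * \<phi> u + b * \<phi> v)"

text \<open>The finite signed measure \<open>h\<mu>\<close>, viewed as the functional \<open>f \<mapsto> \<integral> f h d\<mu>\<close> on \<open>F\<close>.\<close>

definition weighted :: "('a \<Rightarrow> real) set \<Rightarrow> ('a \<Rightarrow> real) \<Rightarrow> 'a measure \<Rightarrow> ('a \<Rightarrow> real) \<Rightarrow> real" where
  "weighted F h \<mu> = (\<lambda>f\<in>F. \<integral>x. f x * h x \<partial>\<mu>)"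

definition envelope :: "('a::topological_space \<Rightarrow> real) \<Rightarrow> ('a \<Rightarrow> real) set \<Rightarrow> bool" where
  "envelope E F \<longleftrightarrow> E \<in> borel_measurable borel \<and> (\<forall>x. 0 \<le> E x) \<and> (\<forall>f\<in>F. \<forall>x. \<bar>f x\<bar> \<le> E x)"


section \<open>Tight Brownian bridges\<close>

definition covariance :: "'w measure \<Rightarrow> ('w \<Rightarrow> real) \<Rightarrow> ('w \<Rightarrow> real) \<Rightarrow> real" where
  "covariance M X Y = (\<integral>w. (X w - (\<integral>u. X u \<partial>M)) * (Y w - (\<integral>u. Y u \<partial>M)) \<partial>M)"

text \<open>Normal laws on the line, point masses included.\<close>

definition gaussian_law :: "real measure \<Rightarrow> bool" where
  "gaussian_law N \<longleftrightarrow>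
     (\<exists>m. N = return borel m) \<or> (\<exists>m \<sigma>. 0 < \<sigma> \<and> N = density lborel (normal_density m \<sigma>))"

definition gaussian_process :: "'i set \<Rightarrow> 'w measure \<Rightarrow> ('w \<Rightarrow> 'i \<Rightarrow> real) \<Rightarrow> bool" where
  "gaussian_process F M G \<longleftrightarrow> prob_space M \<and>
     (\<forall>f\<in>F. (\<lambda>w. G w f) \<in> borel_measurable M) \<and>
     (\<forall>A c. finite A \<and> A \<subseteq> F \<longrightarrow> gaussian_law (distr M borel (\<lambda>w. \<Sum>f\<in>A. c f * G w f)))"

definition tight_in_linf :: "'i set \<Rightarrow> 'w measure \<Rightarrow> ('w \<Rightarrow> 'i \<Rightarrow> real) \<Rightarrow> bool" where
  "tight_in_linf F M G \<longleftrightarrow> G \<in> M \<rightarrow>\<^sub>M linf_borel F \<and>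
     (\<forall>e>0. \<exists>K. compactin (mtopology_of (linf F)) K \<and> measure M {w\<in>space M. G w \<in> K} \<ge> 1 - e)"

text \<open>Square integrability of the members of \<open>F\<close> is required explicitly: it is what makes
  \<open>Cov\<^sub>\<mu>(f,g)\<close> meaningful, whereas \<^const>\<open>covariance\<close> is 0 for a non-integrable product.\<close>

definition brownian_bridge ::
  "('a \<Rightarrow> real) set \<Rightarrow> 'a measure \<Rightarrow> 'w measure \<Rightarrow> ('w \<Rightarrow> ('a \<Rightarrow> real) \<Rightarrow> real) \<Rightarrow> bool" where
  "brownian_bridge F \<mu> M G \<longleftrightarrow>
     (\<forall>f\<in>F. integrable \<mu> (\<lambda>x. (f x)\<^sup>2)) \<and>
     gaussian_process F M G \<and> tight_in_linf F M G \<and>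
     (\<forall>f\<in>F. (\<integral>w. G w f \<partial>M) = 0) \<and>
     (\<forall>f\<in>F. \<forall>g\<in>F. covariance M (\<lambda>w. G w f) (\<lambda>w. G w g) = covariance \<mu> f g)"

text \<open>The type of the sample space cannot be quantified over. Fixing it to the type carrying
  \<^term>\<open>linf F\<close> loses nothing: only the law of \<open>G\<close> matters, and \<open>G\<close> may be replaced by the
  identity on \<^term>\<open>linf F\<close> under that law.\<close>

definition pre_gaussian :: "('a \<Rightarrow> real) set \<Rightarrow> 'a measure \<Rightarrow> bool" where
  "pre_gaussian F \<mu> \<longleftrightarrow>
     (\<exists>(M :: (('a \<Rightarrow> real) \<Rightarrow> real) measure) G. brownian_bridge F \<mu> M G)"


section \<open>Semiparametric efficiency bound\<close>

definition L2 :: "'b measure \<Rightarrow> ('b \<Rightarrow> real) set" where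
  "L2 Q = {h \<in> borel_measurable Q. integrable Q (\<lambda>z. (h z)\<^sup>2)}"

definition L2_norm :: "'b measure \<Rightarrow> ('b \<Rightarrow> real) \<Rightarrow> real" where
  "L2_norm Q h = sqrt (\<integral>z. (h z)\<^sup>2 \<partial>Q)"

text \<open>Continuity with respect to the seminorm forces the functional to respect equality
  \<open>Q\<close>-almost everywhere, so these are the functionals on the space of equivalence classes.\<close>

definition L2_dual :: "'b measure \<Rightarrow> (('b \<Rightarrow> real) \<Rightarrow> real) \<Rightarrow> bool" where
  "L2_dual Q \<Lambda> \<longleftrightarrow>
     (\<forall>u\<in>L2 Q. \<forall>v\<in>L2 Q. \<forall>a b. \<Lambda> (\<lambda>z. a * u z + b * v z) = a * \<Lambda> u + b * \<Lambda> v) \<and>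
     (\<forall>u\<in>L2 Q. \<forall>e>0. \<exists>d>0. \<forall>v\<in>L2 Q.
        L2_norm Q (\<lambda>z. v z - u z) < d \<longrightarrow> \<bar>\<Lambda> v - \<Lambda> u\<bar> < e)"

definition lin :: "('b \<Rightarrow> real) set \<Rightarrow> ('b \<Rightarrow> real) set" where
  "lin T = {(\<lambda>z. \<Sum>g\<in>A. c g * g z) | A c. finite A \<and> A \<subseteq> T}"

definition measure_sum :: "'b measure \<Rightarrow> 'b measure \<Rightarrow> 'b measure" where
  "measure_sum R Q = measure_of (space Q) (sets Q) (\<lambda>A. emeasure R A + emeasure Q A)"

text \<open>\<open>\<integral> [t\<^sup>-\<^sup>1 (dR\<^sup>1\<^sup>/\<^sup>2 - dQ\<^sup>1\<^sup>/\<^sup>2) - h dQ\<^sup>1\<^sup>/\<^sup>2 / 2]\<^sup>2\<close>, computed from densities with respect to the dominating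
  measure \<open>R + Q\<close> (the value does not depend on the dominating measure).\<close>

definition score_defect ::
  "'b measure \<Rightarrow> 'b measure \<Rightarrow> ('b \<Rightarrow> real) \<Rightarrow> real \<Rightarrow> ennreal" where
  "score_defect Q R h t =
     (let D = measure_sum R Q;
          r = (\<lambda>z. sqrt (enn2real (RN_deriv D R z)));
          q = (\<lambda>z. sqrt (enn2real (RN_deriv D Q z)))
      in \<integral>\<^sup>+ z. ennreal (((r z - q z) / t - h z * q z / 2)\<^sup>2) \<partial>D)"

text \<open>A submodel \<open>{Q\<^sub>t : 0 \<le> t < \<epsilon>}\<close> is a pair \<open>(\<epsilon>, Qt)\<close>; the values of \<open>Qt\<close> outside \<open>[0, \<epsilon>)\<close> are
  irrelevant.\<close>

definition submodel :: "'b measure set \<Rightarrow> 'b measure \<Rightarrow> real \<times> (real \<Rightarrow> 'b measure) \<Rightarrow> bool" where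
  "submodel P Q = (\<lambda>(\<epsilon>, Qt). 0 < \<epsilon> \<and> Qt 0 = Q \<and> (\<forall>t\<in>{0..<\<epsilon>}. Qt t \<in> P))"

definition has_score ::
  "'b measure \<Rightarrow> real \<times> (real \<Rightarrow> 'b measure) \<Rightarrow> ('b \<Rightarrow> real) \<Rightarrow> bool" where
  "has_score Q = (\<lambda>(\<epsilon>, Qt) h. h \<in> borel_measurable Q \<and>
     ((\<lambda>t. score_defect Q (Qt t) h t) \<longlongrightarrow> 0) (at_right 0))"

text \<open>Scores are determined only \<open>Q\<close>-almost everywhere, so a tangent set is required to contain
  some version of the score of each submodel in the collection, and nothing but scores.\<close>

definition tangent_set ::
  "'b measure set \<Rightarrow> 'b measure \<Rightarrow> (real \<times> (real \<Rightarrow> 'b measure)) set \<Rightarrow> ('b \<Rightarrow> real) set \<Rightarrow> bool" where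
  "tangent_set P Q \<C> T \<longleftrightarrow>
     (\<forall>s\<in>\<C>. submodel P Q s \<and> (\<exists>h\<in>T. has_score Q s h)) \<and>
     (\<forall>h\<in>T. \<exists>s\<in>\<C>. has_score Q s h)"

definition tangent_space ::
  "'b measure set \<Rightarrow> 'b measure \<Rightarrow> (real \<times> (real \<Rightarrow> 'b measure)) set \<Rightarrow> ('b \<Rightarrow> real) set \<Rightarrow> bool" where
  "tangent_space P Q \<C> T \<longleftrightarrow> tangent_set P Q \<C> T \<and> T \<subseteq> L2 Q \<and> (\<lambda>_. 0) \<in> T \<and>
     (\<forall>g\<in>T. \<forall>h\<in>T. \<forall>a b. (\<lambda>z. a * g z + b * h z) \<in> T)"

definition has_pathwise_derivative ::
  "('b measure \<Rightarrow> real) \<Rightarrow> 'b measure \<Rightarrow> (real \<times> (real \<Rightarrow> 'b measure)) set \<Rightarrow> ('b \<Rightarrow> real) set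
     \<Rightarrow> (('b \<Rightarrow> real) \<Rightarrow> real) \<Rightarrow> bool" where
  "has_pathwise_derivative \<kappa> Q \<C> T \<Lambda> \<longleftrightarrow> L2_dual Q \<Lambda> \<and>
     (\<forall>h\<in>T. \<forall>(\<epsilon>, Qt)\<in>\<C>. has_score Q (\<epsilon>, Qt) h \<longrightarrow>
        ((\<lambda>t. (\<kappa> (Qt t) - \<kappa> Q) / t) \<longlongrightarrow> \<Lambda> h) (at_right 0))"

text \<open>The supremum is taken in \<open>[0, \<infinity>]\<close>; in particular it is 0 when \<^term>\<open>lin T\<close> contains no
  nonzero element of \<open>L\<^sup>2(Q)\<close>.\<close>

definition efficiency_bound ::
  "'b measure \<Rightarrow> ('b \<Rightarrow> real) set \<Rightarrow> (('b \<Rightarrow> real) \<Rightarrow> real) \<Rightarrow> ennreal" where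
  "efficiency_bound Q T \<Lambda> =
     (SUP h\<in>{h \<in> lin T. L2_norm Q h \<noteq> 0}. ennreal ((\<Lambda> h)\<^sup>2 / (L2_norm Q h)\<^sup>2))"


section \<open>The product model\<close>

definition product_model :: "'a measure set \<Rightarrow> 'a measure set \<Rightarrow> ('a \<times> 'a) measure set" where
  "product_model A B = {\<rho>1 \<Otimes>\<^sub>M \<rho>2 | \<rho>1 \<rho>2. \<rho>1 \<in> A \<and> \<rho>2 \<in> B}"

definition bounded_scores :: "'a::topological_space measure \<Rightarrow> ('a \<Rightarrow> real) set" where
  "bounded_scores \<mu> =
     {h \<in> borel_measurable borel. (\<exists>B. \<forall>x. \<bar>h x\<bar> \<le> B) \<and> (\<integral>x. h x \<partial>\<mu>) = 0}"

definition dsum :: "('a \<Rightarrow> real) \<Rightarrow> ('a \<Rightarrow> real) \<Rightarrow> 'a \<times> 'a \<Rightarrow> real" where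
  "dsum h1 h2 = (\<lambda>(x, y). h1 x + h2 y)"

definition product_tangent ::
  "'a::topological_space measure \<Rightarrow> 'a measure \<Rightarrow> ('a \<times> 'a \<Rightarrow> real) set" where
  "product_tangent \<mu> \<nu> = {dsum h1 h2 | h1 h2. h1 \<in> bounded_scores \<mu> \<and> h2 \<in> bounded_scores \<nu>}"

text \<open>The measure \<open>(1 + t h)\<mu>\<close>; \<^const>\<open>ennreal\<close> truncates negative values, which do not occur for
  bounded \<open>h\<close> and small \<open>t\<close>.\<close>

definition tilt :: "'a measure \<Rightarrow> ('a \<Rightarrow> real) \<Rightarrow> real \<Rightarrow> 'a measure" where
  "tilt \<mu> h t = density \<mu> (\<lambda>x. ennreal (1 + t * h x))"

definition tilt_submodels ::
  "('a \<times> 'a) measure set \<Rightarrow> 'a::topological_space measure \<Rightarrow> 'a measure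
     \<Rightarrow> (real \<times> (real \<Rightarrow> ('a \<times> 'a) measure)) set" where
  "tilt_submodels P \<mu> \<nu> =
     {s. submodel P (\<mu> \<Otimes>\<^sub>M \<nu>) s \<and>
         (\<exists>\<epsilon>. \<exists>h1\<in>bounded_scores \<mu>. \<exists>h2\<in>bounded_scores \<nu>.
            s = (\<epsilon>, \<lambda>t. tilt \<mu> h1 t \<Otimes>\<^sub>M tilt \<nu> h2 t))}"

end

theory Submission
  imports Defs
begin

text \<open>
  For one marginal, the map \<open>f - \<mu>f \<mapsto> G\<^sub>\<mu>(f)\<close> is an isometry into \<open>L\<^sup>2\<close> of the sample space, since
  the bridge has the covariances of \<open>F\<close> under \<open>\<mu>\<close>. Tightness places \<open>\<delta>'\<^sub>\<mu>(G\<^sub>\<mu>)\<close> in the closure of its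
  range, so there is a centred \<open>\<phi>\<close> in \<open>L\<^sup>2(\<mu>)\<close> with \<open>\<parallel>\<phi>\<parallel>\<^sup>2 = Var(\<delta>'\<^sub>\<mu>(G\<^sub>\<mu>))\<close>. The same
  approximation shows \<open>\<delta>'\<^sub>\<mu>(h\<mu>) = \<integral>\<phi>h d\<mu>\<close> for bounded centred \<open>h\<close>: the function \<open>\<phi>\<close> is the
  influence function (lemma \<open>influence_function\<close>). Let \<open>\<psi>\<close> be the one for \<open>\<nu>\<close>.

  Hence the directional derivative of \<open>\<delta>\<close> along \<open>h\<^sub>1 \<oplus> h\<^sub>2\<close> is the inner product of \<open>h\<^sub>1 \<oplus> h\<^sub>2\<close> with
  \<open>\<Phi> = \<phi> \<oplus> \<psi>\<close> in \<open>L\<^sup>2(\<mu> \<otimes> \<nu>)\<close>, which is continuous (lemma \<open>pathwise_derivative\<close>). The bound is the squared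
  norm of \<open>\<Phi>\<close>, because \<open>\<Phi>\<close> lies in the closure of the tangent space, and this norm splits into the two
  variances because centred functions of independent coordinates are orthogonal (lemma
  \<open>efficiency_bound_eq\<close>).

  Two points carry the analysis. Tightness only controls \<open>G\<^sub>\<mu>\<close> in probability, and moments are
  recovered from the fact that a centred Gaussian variable with mass \<open>1/2\<close> near 0 has small variance
  (lemma \<open>gaussian_small_ball\<close>). And a path of tilted measures must have a unique score, which
  follows by computing its Hellinger integral with respect to \<open>\<mu> \<otimes> \<nu>\<close> (lemmas
  \<open>score_defect_density\<close> and \<open>tilt_score_unique\<close>).
\<close>

section \<open>Bounded functions on a function class\<close>

lemma mspace_linf_iff:
  "u \<in> mspace (linf F) \<longleftrightarrow> u \<in> extensional F \<and> (\<exists>B. \<forall>f\<in>F. \<bar>u f\<bar> \<le> B)"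
proof -
  have "Metric_space.mbounded UNIV dist (u ` F) \<longleftrightarrow> (\<exists>B. \<forall>f\<in>F. \<bar>u f\<bar> \<le> B)"
    by (auto simp: mbounded_iff_bounded bounded_iff)
  then show ?thesis
    by (auto simp: Met_TC.fspace_def)
qed

lemma linf_combination:
  assumes "u \<in> mspace (linf F)" "v \<in> mspace (linf F)"
  shows "(\<lambda>f\<in>F. a * u f + b * v f) \<in> mspace (linf F)"
proof -
  obtain B C where B: "\<forall>f\<in>F. \<bar>u f\<bar> \<le> B" and C: "\<forall>f\<in>F. \<bar>v f\<bar> \<le> C"
    using assms unfolding mspace_linf_iff by blast
  have "\<bar>a * u f + b * v f\<bar> \<le> \<bar>a\<bar> * B + \<bar>b\<bar> * C" if "f \<in> F" for f
  proof -
    have "\<bar>a * u f + b * v f\<bar> \<le> \<bar>a\<bar> * \<bar>u f\<bar> + \<bar>b\<bar> * \<bar>v f\<bar>"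
      by (metis abs_mult abs_triangle_ineq)
    then show ?thesis
      using B C that by (smt (verit) abs_ge_zero mult_left_mono)
  qed
  then show ?thesis unfolding mspace_linf_iff by auto
qed

lemma linf_dist_le:
  assumes "u \<in> mspace (linf F)" "v \<in> mspace (linf F)" "0 \<le> r" "\<And>f. f \<in> F \<Longrightarrow> \<bar>u f - v f\<bar> \<le> r"
  shows "mdist (linf F) u v \<le> r"
proof (cases "F = {}")
  case True then show ?thesis using assms by (simp add: Met_TC.fdist_def)
next
  case False
  then show ?thesis using assms
    by (auto simp: Met_TC.fdist_def dist_real_def intro!: cSUP_least)
qed

lemma linf_dist_ge:
  assumes "u \<in> mspace (linf F)" "v \<in> mspace (linf F)" "f \<in> F"
  shows "\<bar>u f - v f\<bar> \<le> mdist (linf F) u v"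
proof -
  obtain B C where B: "\<forall>f\<in>F. \<bar>u f\<bar> \<le> B" and C: "\<forall>f\<in>F. \<bar>v f\<bar> \<le> C"
    using assms unfolding mspace_linf_iff by blast
  have "bdd_above ((\<lambda>x. dist (u x) (v x)) ` F)"
    using B C by (intro bdd_aboveI2[where M="B + C"]) (force simp: dist_real_def)
  then have "dist (u f) (v f) \<le> (SUP x\<in>F. dist (u x) (v x))"
    using assms(3) by (rule cSUP_upper2) auto
  then show ?thesis using assms by (auto simp: Met_TC.fdist_def dist_real_def)
qed

lemma linf_dual_combination:
  assumes "linf_dual F \<phi>" "u \<in> mspace (linf F)" "v \<in> mspace (linf F)"
  shows "\<phi> (\<lambda>f\<in>F. a * u f + b * v f) = a * \<phi> u + b * \<phi> v"
  using assms unfolding linf_dual_def by blast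

lemma linf_dual_zero:
  assumes "linf_dual F \<phi>"
  shows "\<phi> (\<lambda>f\<in>F. 0) = 0"
proof -
  have "(\<lambda>f\<in>F. 0) \<in> mspace (linf F)" unfolding mspace_linf_iff by auto
  from linf_dual_combination[OF assms this this, of 0 0] show ?thesis by simp
qed

text \<open>The operator norm bound, obtained from continuity at 0 by rescaling. It is stated through pointwise
  bounds on \<open>F\<close>, so that later arguments never compute a supremum.\<close>

lemma linf_dual_Lipschitz:
  assumes \<phi>: "linf_dual F \<phi>"
  obtains C where "0 < C"
    "\<And>u v r. \<lbrakk>u \<in> mspace (linf F); v \<in> mspace (linf F); 0 < r; \<And>f. f \<in> F \<Longrightarrow> \<bar>u f - v f\<bar> \<le> r\<rbrakk>
       \<Longrightarrow> \<bar>\<phi> u - \<phi> v\<bar> \<le> C * r"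
proof -
  let ?z = "\<lambda>f\<in>F. 0 :: real"
  have z: "?z \<in> mspace (linf F)" unfolding mspace_linf_iff by auto
  interpret L: Metric_space "mspace (linf F)" "mdist (linf F)"
    by (rule Metric_space_mspace_mdist)
  have "continuous_map (mtopology_of (linf F)) (mtopology_of euclidean_metric) \<phi>"
    using \<phi> by (simp add: linf_dual_def)
  then have "\<exists>d>0. \<forall>x. x \<in> mspace (linf F) \<and> mdist (linf F) ?z x < d \<longrightarrow> dist (\<phi> ?z) (\<phi> x) < 1"
    using z unfolding mtopology_of_def
    by (subst (asm) L.metric_continuous_map) (simp_all add: Met_TC.Metric_space_axioms del: mspace_funspace mdist_funspace, (metis zero_less_one)?)
  then obtain d where d: "d > 0"
    "\<And>x. x \<in> mspace (linf F) \<Longrightarrow> mdist (linf F) ?z x < d \<Longrightarrow> \<bar>\<phi> x\<bar> < 1"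
    by (auto simp: linf_dual_zero[OF \<phi>] dist_real_def simp del: mspace_funspace mdist_funspace)
  show ?thesis
  proof (rule that[of "2 / d"])
    show "0 < 2 / d" using d by simp
    fix u v r
    assume u: "u \<in> mspace (linf F)" and v: "v \<in> mspace (linf F)" and r: "(0::real) < r"
      and uv: "\<And>f. f \<in> F \<Longrightarrow> \<bar>u f - v f\<bar> \<le> r"
    \<comment> \<open>the factor that shrinks \<open>u - v\<close> into the ball on which \<open>\<phi>\<close> is below 1\<close>
    define k where "k = d / (2 * r)"
    have k: "k > 0" using d r by (simp add: k_def)
    let ?w = "\<lambda>f\<in>F. k * u f + (- k) * v f"
    have w: "?w \<in> mspace (linf F)" using u v by (rule linf_combination)
    have "mdist (linf F) ?z ?w \<le> d / 2"
    proof (rule linf_dist_le[OF z w])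
      fix f assume f: "f \<in> F"
      have "\<bar>k * u f - k * v f\<bar> = k * \<bar>u f - v f\<bar>"
        using k by (simp add: abs_mult flip: right_diff_distrib)
      also have "\<dots> \<le> k * r" using uv[OF f] k by simp
      also have "\<dots> = d / 2" using r by (simp add: k_def)
      finally show "\<bar>?z f - ?w f\<bar> \<le> d / 2" using f by (simp add: abs_minus_commute)
    qed (use d in simp)
    then have "\<bar>\<phi> ?w\<bar> < 1" using d w by simp
    moreover have "\<phi> ?w = k * (\<phi> u - \<phi> v)"
      using linf_dual_combination[OF \<phi> u v, of k "- k"] by (simp add: right_diff_distrib)
    ultimately have "k * \<bar>\<phi> u - \<phi> v\<bar> < 1" using k by (simp add: abs_mult)
    then show "\<bar>\<phi> u - \<phi> v\<bar> \<le> 2 / d * r"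
      using d r by (simp add: k_def field_simps)
  qed
qed

lemma linf_dual_measurable:
  assumes "linf_dual F \<phi>"
  shows "\<phi> \<in> borel_measurable (linf_borel F)"
proof (rule borel_measurableI)
  fix S :: "real set" assume "open S"
  have sub: "{U. openin (mtopology_of (linf F)) U} \<subseteq> Pow (mspace (linf F))"
    using openin_subset topspace_mtopology_of by fastforce
  have "openin (mtopology_of (linf F)) {x \<in> topspace (mtopology_of (linf F)). \<phi> x \<in> S}"
    using assms \<open>open S\<close> unfolding linf_dual_def
    by (intro openin_continuous_map_preimage[where Y=euclideanreal]) auto
  moreover have "\<phi> -` S \<inter> space (linf_borel F) = {x \<in> topspace (mtopology_of (linf F)). \<phi> x \<in> S}"
    using sub by (auto simp: linf_borel_def space_measure_of simp del: mspace_funspace)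
  ultimately show "\<phi> -` S \<inter> space (linf_borel F) \<in> sets (linf_borel F)"
    using sub by (auto simp: linf_borel_def sets_measure_of simp del: mspace_funspace)
qed

text \<open>A compact set of bounded functions can be discretised uniformly: up to \<open>\<eta>\<close>, its members
  factor through one map \<open>\<pi>\<close> with finite range. Two indices on which all members of a finite
  \<open>\<eta>/4\<close>-net agree up to rounding are interchangeable for the whole set, and the rounded
  values take only finitely many values because each member of the net is bounded.\<close>

lemma linf_compact_finite_range:
  assumes K: "compactin (mtopology_of (linf F)) K" and \<eta>: "0 < \<eta>"
  obtains \<pi> where "\<pi> \<in> F \<rightarrow> F" "finite (\<pi> ` F)"
    "\<And>u f. u \<in> K \<Longrightarrow> f \<in> F \<Longrightarrow> \<bar>u f - u (\<pi> f)\<bar> \<le> \<eta>"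
proof -
  interpret L: Metric_space "mspace (linf F)" "mdist (linf F)"
    by (rule Metric_space_mspace_mdist)
  have "L.mtotally_bounded K"
    using K L.compactin_imp_mtotally_bounded by (simp add: mtopology_of_def)
  then have "\<forall>\<epsilon>>0. \<exists>N. finite N \<and> N \<subseteq> K \<and> K \<subseteq> (\<Union>x\<in>N. L.mball x \<epsilon>)"
    unfolding L.mtotally_bounded_def .
  then have "0 < \<eta> / 4 \<longrightarrow> (\<exists>N. finite N \<and> N \<subseteq> K \<and> K \<subseteq> (\<Union>x\<in>N. L.mball x (\<eta> / 4)))"
    by (rule spec)
  then have "\<exists>N. finite N \<and> N \<subseteq> K \<and> K \<subseteq> (\<Union>x\<in>N. L.mball x (\<eta> / 4))"
    by (rule mp) (use \<eta> in simp)
  then obtain N where N: "finite N" "N \<subseteq> K" "K \<subseteq> (\<Union>x\<in>N. L.mball x (\<eta> / 4))"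
    by (elim exE conjE)
  have KM: "K \<subseteq> mspace (linf F)" using K compactin_subset_topspace by fastforce
  define key where "key f = (\<lambda>u\<in>N. \<lfloor>u f * (4 / \<eta>)\<rfloor>)" for f
  define rep where "rep k = (SOME f. f \<in> F \<and> key f = k)" for k
  define \<pi> where "\<pi> f = rep (key f)" for f
  have rep: "\<pi> f \<in> F \<and> key (\<pi> f) = key f" if "f \<in> F" for f
    unfolding \<pi>_def rep_def by (rule someI[of _ f]) (use that in simp)
  have "finite (key ` F)"
  proof (rule finite_subset)
    show "key ` F \<subseteq> (\<Pi>\<^sub>E u\<in>N. (\<lambda>f. \<lfloor>u f * (4 / \<eta>)\<rfloor>) ` F)"
      by (auto simp: key_def)
    show "finite (\<Pi>\<^sub>E u\<in>N. (\<lambda>f. \<lfloor>u f * (4 / \<eta>)\<rfloor>) ` F)"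
    proof (rule finite_PiE[OF N(1)])
      fix u assume "u \<in> N"
      then obtain B where B: "\<forall>f\<in>F. \<bar>u f\<bar> \<le> B" using N KM unfolding mspace_linf_iff[THEN eq_reflection] subset_iff by blast
      have "(\<lambda>f. \<lfloor>u f * (4 / \<eta>)\<rfloor>) ` F \<subseteq> {\<lfloor>- B * (4 / \<eta>)\<rfloor> .. \<lfloor>B * (4 / \<eta>)\<rfloor>}"
      proof (rule image_subsetI)
        fix f assume "f \<in> F"
        then have "- B \<le> u f" "u f \<le> B" using B by force+
        then have "- B * (4 / \<eta>) \<le> u f * (4 / \<eta>)" "u f * (4 / \<eta>) \<le> B * (4 / \<eta>)"
          using \<eta> by (intro mult_right_mono; simp)+
        then show "\<lfloor>u f * (4 / \<eta>)\<rfloor> \<in> {\<lfloor>- B * (4 / \<eta>)\<rfloor> .. \<lfloor>B * (4 / \<eta>)\<rfloor>}"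
          using floor_mono by auto
      qed
      then show "finite ((\<lambda>f. \<lfloor>u f * (4 / \<eta>)\<rfloor>) ` F)" by (rule finite_subset) simp
    qed
  qed
  then have fin: "finite (\<pi> ` F)" unfolding \<pi>_def by (metis finite_imageI image_image)
  have close: "\<bar>u f - u (\<pi> f)\<bar> \<le> \<eta>" if u: "u \<in> K" and f: "f \<in> F" for u f
  proof -
    obtain x where x: "x \<in> N" and xu: "u \<in> L.mball x (\<eta> / 4)" using N u by blast
    have xM: "x \<in> mspace (linf F)" "u \<in> mspace (linf F)" using x u N KM by blast+
    have d: "mdist (linf F) x u \<le> \<eta> / 4" using xu by (simp add: L.in_mball del: mdist_funspace mspace_funspace)
    have 1: "\<bar>x f - u f\<bar> \<le> \<eta> / 4" "\<bar>x (\<pi> f) - u (\<pi> f)\<bar> \<le> \<eta> / 4"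
      using order_trans[OF linf_dist_ge[OF xM] d] rep[OF f] f by blast+
    have "\<lfloor>x f * (4 / \<eta>)\<rfloor> = \<lfloor>x (\<pi> f) * (4 / \<eta>)\<rfloor>"
      using rep[OF f] x unfolding key_def by (metis (no_types, lifting) restrict_apply')
    then have "\<bar>x f * (4 / \<eta>) - x (\<pi> f) * (4 / \<eta>)\<bar> \<le> 1" by linarith
    then have "\<bar>x f - x (\<pi> f)\<bar> * (4 / \<eta>) \<le> 1"
      using \<eta> by (simp only: left_diff_distrib[symmetric] abs_mult[of _ "4 / \<eta>"]) simp
    then have "\<bar>x f - x (\<pi> f)\<bar> \<le> \<eta> / 4" using \<eta> by (simp add: field_simps)
    then show ?thesis using 1 by linarith
  qed
  show ?thesis using that[of \<pi>] rep fin close by blast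
qed

lemma linf_comp:
  assumes "u \<in> mspace (linf F)" "\<pi> \<in> F \<rightarrow> F"
  shows "(\<lambda>f\<in>F. u (\<pi> f)) \<in> mspace (linf F)"
  using assms unfolding mspace_linf_iff by (auto simp: Pi_iff)

text \<open>On functions that factor through a finite-range map, a functional is a finite linear combination
  of evaluations. This is what turns \<open>\<delta>(G)\<close> into a limit of finite-dimensional Gaussian
  variables.\<close>

lemma linf_dual_finite_range:
  assumes \<phi>: "linf_dual F \<phi>" and \<pi>: "\<pi> \<in> F \<rightarrow> F" "finite (\<pi> ` F)"
  shows "\<phi> (\<lambda>f\<in>F. u (\<pi> f)) = (\<Sum>g\<in>\<pi> ` F. \<phi> (\<lambda>f\<in>F. of_bool (\<pi> f = g)) * u g)"
proof -
  have ind: "(\<lambda>f\<in>F. of_bool (\<pi> f = g)) \<in> mspace (linf F)" for g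
    unfolding mspace_linf_iff by (auto intro!: exI[of _ 1])
  have "(\<lambda>f\<in>F. \<Sum>g\<in>B. u g * of_bool (\<pi> f = g)) \<in> mspace (linf F) \<and>
     \<phi> (\<lambda>f\<in>F. \<Sum>g\<in>B. u g * of_bool (\<pi> f = g)) =
     (\<Sum>g\<in>B. \<phi> (\<lambda>f\<in>F. of_bool (\<pi> f = g)) * u g)" if "finite B" for B
    using that
  proof induction
    case empty
    have "(\<lambda>f\<in>F. 0) \<in> mspace (linf F)" unfolding mspace_linf_iff by auto
    then show ?case by (simp only: sum.empty linf_dual_zero[OF \<phi>] simp_thms)
  next
    case (insert g B)
    let ?v = "\<lambda>f\<in>F. \<Sum>g\<in>B. u g * of_bool (\<pi> f = g)"
    have v: "?v \<in> mspace (linf F)" using insert by blast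
    have eq: "(\<lambda>f\<in>F. \<Sum>g\<in>insert g B. u g * of_bool (\<pi> f = g)) =
       (\<lambda>f\<in>F. u g * (\<lambda>f\<in>F. of_bool (\<pi> f = g)) f + 1 * ?v f)"
      using insert.hyps by (intro ext) (simp add: restrict_def)
    show ?case
      unfolding eq
    proof
      show "(\<lambda>f\<in>F. u g * (\<lambda>f\<in>F. of_bool (\<pi> f = g)) f + 1 * ?v f) \<in> mspace (linf F)"
        by (rule linf_combination[OF ind v])
      have "\<phi> (\<lambda>f\<in>F. u g * (\<lambda>f\<in>F. of_bool (\<pi> f = g)) f + 1 * ?v f)
          = u g * \<phi> (\<lambda>f\<in>F. of_bool (\<pi> f = g)) + 1 * \<phi> ?v"
        by (rule linf_dual_combination[OF \<phi> ind v])
      also have "\<dots> = (\<Sum>g\<in>insert g B. \<phi> (\<lambda>f\<in>F. of_bool (\<pi> f = g)) * u g)"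
        by (subst conjunct2[OF insert.IH]) (use insert.hyps in simp)
      finally show "\<phi> (\<lambda>f\<in>F. u g * (\<lambda>f\<in>F. of_bool (\<pi> f = g)) f + 1 * ?v f)
          = (\<Sum>g\<in>insert g B. \<phi> (\<lambda>f\<in>F. of_bool (\<pi> f = g)) * u g)" .
    qed
  qed
  from conjunct2[OF this[OF \<pi>(2)]]
  have "\<phi> (\<lambda>f\<in>F. \<Sum>g\<in>\<pi> ` F. u g * of_bool (\<pi> f = g)) =
     (\<Sum>g\<in>\<pi> ` F. \<phi> (\<lambda>f\<in>F. of_bool (\<pi> f = g)) * u g)" .
  moreover have "(\<lambda>f\<in>F. \<Sum>g\<in>\<pi> ` F. u g * of_bool (\<pi> f = g)) = (\<lambda>f\<in>F. u (\<pi> f))"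
    using \<pi>(2) by (intro ext) (auto simp: restrict_def of_bool_def sum.delta if_distrib cong: if_cong)
  ultimately show ?thesis by simp
qed

section \<open>Square-integrable functions\<close>

lemma abs_integral_le:
  fixes f g :: "'b \<Rightarrow> real"
  assumes "integrable M f" "integrable M g" "\<And>x. \<bar>f x\<bar> \<le> g x"
  shows "\<bar>\<integral>x. f x \<partial>M\<bar> \<le> (\<integral>x. g x \<partial>M)"
  by (rule order_trans[OF integral_abs_bound]) (use assms in \<open>auto intro!: integral_mono\<close>)

lemma L2_mult_integrable:
  assumes "u \<in> L2 M" "v \<in> L2 M"
  shows "integrable M (\<lambda>x. u x * v x)"
proof (rule Bochner_Integration.integrable_bound)
  show "integrable M (\<lambda>x. (u x)\<^sup>2 + (v x)\<^sup>2)" using assms by (simp add: L2_def)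
  show "(\<lambda>x. u x * v x) \<in> borel_measurable M" using assms by (auto simp: L2_def)
  have "\<bar>a * b\<bar> \<le> a\<^sup>2 + b\<^sup>2" for a b :: real
    using sum_squares_bound[of "\<bar>a\<bar>" "\<bar>b\<bar>"] abs_ge_zero[of "a * b"]
    unfolding abs_mult power2_abs by linarith
  then show "AE x in M. norm (u x * v x) \<le> norm ((u x)\<^sup>2 + (v x)\<^sup>2)" by simp
qed

lemma L2_combination:
  assumes "u \<in> L2 M" "v \<in> L2 M"
  shows "(\<lambda>x. a * u x + b * v x) \<in> L2 M"
proof -
  have "integrable M (\<lambda>x. a\<^sup>2 * (u x)\<^sup>2 + 2 * a * b * (u x * v x) + b\<^sup>2 * (v x)\<^sup>2)"
    using assms L2_mult_integrable[OF assms] by (auto simp: L2_def)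
  moreover have "(\<lambda>x. a\<^sup>2 * (u x)\<^sup>2 + 2 * a * b * (u x * v x) + b\<^sup>2 * (v x)\<^sup>2) = (\<lambda>x. (a * u x + b * v x)\<^sup>2)"
    by (auto simp: power2_eq_square algebra_simps)
  ultimately show ?thesis using assms by (auto simp: L2_def)
qed

lemma L2_diff: "u \<in> L2 M \<Longrightarrow> v \<in> L2 M \<Longrightarrow> (\<lambda>x. u x - v x) \<in> L2 M"
  using L2_combination[of u M v 1 "-1"] by simp

lemma L2_zero: "(\<lambda>x. 0) \<in> L2 M"
  by (simp add: L2_def)

lemma L2_sum:
  assumes "\<And>i. i \<in> A \<Longrightarrow> u i \<in> L2 M"
  shows "(\<lambda>x. \<Sum>i\<in>A. c i * u i x) \<in> L2 M"
  using assms
proof (induction A rule: infinite_finite_induct)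
  case (insert i A)
  then show ?case using L2_combination[of "u i" M "\<lambda>x. \<Sum>i\<in>A. c i * u i x" "c i" 1] by simp
qed (simp_all add: L2_zero)

lemma L2_bounded:
  assumes "finite_measure M" "u \<in> borel_measurable M" "\<And>x. \<bar>u x\<bar> \<le> B"
  shows "u \<in> L2 M"
proof -
  interpret finite_measure M by fact
  have "(u x)\<^sup>2 \<le> B\<^sup>2" for x using assms(3)[of x] by (rule abs_le_square_iff[THEN iffD1, OF order_trans]) simp
  then show ?thesis using assms(2)
    by (auto simp: L2_def intro!: integrable_const_bound[where B="B\<^sup>2"])
qed

lemma L2_const: "finite_measure M \<Longrightarrow> (\<lambda>x. c) \<in> L2 M"
  by (rule L2_bounded[where B="\<bar>c\<bar>"]) auto

lemma L2_integrable:
  assumes "finite_measure M" "u \<in> L2 M"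
  shows "integrable M u"
  using L2_mult_integrable[OF assms(2) L2_const[OF assms(1), of 1]] by simp

lemma integral_square_combination:
  assumes "u \<in> L2 M" "v \<in> L2 M"
  shows "(\<integral>x. (u x + t * v x)\<^sup>2 \<partial>M) = (\<integral>x. (u x)\<^sup>2 \<partial>M) + 2 * t * (\<integral>x. u x * v x \<partial>M) + t\<^sup>2 * (\<integral>x. (v x)\<^sup>2 \<partial>M)"
proof -
  have "(\<lambda>x. (u x + t * v x)\<^sup>2) = (\<lambda>x. (u x)\<^sup>2 + 2 * t * (u x * v x) + t\<^sup>2 * (v x)\<^sup>2)"
    by (auto simp: power2_eq_square algebra_simps)
  then show ?thesis using assms L2_mult_integrable[OF assms] by (simp add: L2_def)
qed

lemma L2_Cauchy_Schwarz:
  assumes "u \<in> L2 M" "v \<in> L2 M"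
  shows "\<bar>\<integral>x. u x * v x \<partial>M\<bar> \<le> L2_norm M u * L2_norm M v"
proof -
  let ?A = "\<integral>x. (u x)\<^sup>2 \<partial>M" and ?B = "\<integral>x. u x * v x \<partial>M" and ?C = "\<integral>x. (v x)\<^sup>2 \<partial>M"
  have nonneg: "0 \<le> ?A + 2 * t * ?B + t\<^sup>2 * ?C" for t
    unfolding integral_square_combination[OF assms, symmetric] by (rule integral_nonneg_AE) simp
  have "0 \<le> ?C" by simp
  \<comment> \<open>the quadratic \<open>\<integral>(u + tv)\<^sup>2\<close> in \<open>t\<close> is nonnegative; evaluate it at its minimum\<close>
  have "?B\<^sup>2 \<le> ?A * ?C"
  proof (cases "?C = 0")
    case True
    have "?B = 0"
    proof (rule ccontr)
      assume "?B \<noteq> 0"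
      then have "2 * (- (?A + 1) / (2 * ?B)) * ?B = - (?A + 1)" by simp
      then show False using nonneg[of "- (?A + 1) / (2 * ?B)"] unfolding True by linarith
    qed
    then show ?thesis using True by simp
  next
    case False
    then have "?C > 0" using \<open>0 \<le> ?C\<close> by linarith
    then show ?thesis using nonneg[of "- ?B / ?C"] by (simp add: field_simps power2_eq_square)
  qed
  then have "sqrt (?B\<^sup>2) \<le> sqrt (?A * ?C)" by (rule real_sqrt_le_mono)
  then show ?thesis by (simp add: L2_norm_def real_sqrt_mult)
qed

lemma inner_L2_dual:
  assumes \<Phi>: "\<Phi> \<in> L2 R"
  shows "L2_dual R (\<lambda>h. \<integral>z. h z * \<Phi> z \<partial>R)"
  unfolding L2_dual_def
proof (intro conjI ballI allI impI)
  fix u v and a b :: real assume u: "u \<in> L2 R" and v: "v \<in> L2 R"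
  show "(\<integral>z. (a * u z + b * v z) * \<Phi> z \<partial>R) = a * (\<integral>z. u z * \<Phi> z \<partial>R) + b * (\<integral>z. v z * \<Phi> z \<partial>R)"
    using L2_mult_integrable[OF u \<Phi>] L2_mult_integrable[OF v \<Phi>] by (simp add: distrib_right mult.assoc)
next
  fix u and e :: real assume u: "u \<in> L2 R" and e: "0 < e"
  \<comment> \<open>positive even when \<open>\<Phi>\<close> vanishes\<close>
  define k where "k = L2_norm R \<Phi> + 1"
  have k: "L2_norm R \<Phi> \<le> k" "0 < k" by (auto simp: k_def L2_norm_def add_nonneg_pos)
  show "\<exists>d>0. \<forall>v\<in>L2 R. L2_norm R (\<lambda>z. v z - u z) < d \<longrightarrow> \<bar>(\<integral>z. v z * \<Phi> z \<partial>R) - (\<integral>z. u z * \<Phi> z \<partial>R)\<bar> < e"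
  proof (intro exI[of _ "e / k"] conjI ballI impI)
    show "0 < e / k" using e k by simp
    fix v assume v: "v \<in> L2 R" and d: "L2_norm R (\<lambda>z. v z - u z) < e / k"
    have "\<bar>(\<integral>z. v z * \<Phi> z \<partial>R) - (\<integral>z. u z * \<Phi> z \<partial>R)\<bar> = \<bar>\<integral>z. (v z - u z) * \<Phi> z \<partial>R\<bar>"
      using L2_mult_integrable[OF u \<Phi>] L2_mult_integrable[OF v \<Phi>] by (simp add: left_diff_distrib)
    also have "\<dots> \<le> L2_norm R (\<lambda>z. v z - u z) * L2_norm R \<Phi>"
      by (rule L2_Cauchy_Schwarz[OF L2_diff[OF v u] \<Phi>])
    also have "\<dots> \<le> L2_norm R (\<lambda>z. v z - u z) * k"
      using k by (intro mult_left_mono) (auto simp: L2_norm_def)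
    also have "\<dots> < e" using d k by (simp add: less_divide_eq)
    finally show "\<bar>(\<integral>z. v z * \<Phi> z \<partial>R) - (\<integral>z. u z * \<Phi> z \<partial>R)\<bar> < e" .
  qed
qed

lemma L2_tendsto_inner:
  assumes X: "\<And>n. X n \<in> L2 M" and Y: "Y \<in> L2 M" and Z: "Z \<in> L2 M"
    and lim: "(\<lambda>n. \<integral>x. (X n x - Y x)\<^sup>2 \<partial>M) \<longlonglongrightarrow> 0"
  shows "(\<lambda>n. \<integral>x. X n x * Z x \<partial>M) \<longlonglongrightarrow> (\<integral>x. Y x * Z x \<partial>M)"
proof -
  have "(\<lambda>n. (\<integral>x. X n x * Z x \<partial>M) - (\<integral>x. Y x * Z x \<partial>M)) \<longlonglongrightarrow> 0"
  proof (rule Lim_null_comparison)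
    show "\<forall>\<^sub>F n in sequentially. norm ((\<integral>x. X n x * Z x \<partial>M) - (\<integral>x. Y x * Z x \<partial>M))
        \<le> L2_norm M (\<lambda>x. X n x - Y x) * L2_norm M Z"
    proof (rule always_eventually, rule allI)
      fix n
      have "(\<integral>x. X n x * Z x \<partial>M) - (\<integral>x. Y x * Z x \<partial>M) = (\<integral>x. (X n x - Y x) * Z x \<partial>M)"
        using L2_mult_integrable[OF X Z] L2_mult_integrable[OF Y Z] by (simp add: left_diff_distrib)
      then show "norm ((\<integral>x. X n x * Z x \<partial>M) - (\<integral>x. Y x * Z x \<partial>M))
          \<le> L2_norm M (\<lambda>x. X n x - Y x) * L2_norm M Z"
        using L2_Cauchy_Schwarz[OF L2_diff[OF X Y] Z] by simp
    qed
    show "(\<lambda>n. L2_norm M (\<lambda>x. X n x - Y x) * L2_norm M Z) \<longlonglongrightarrow> 0"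
      using tendsto_mult_left_zero[OF tendsto_real_sqrt[OF lim, simplified]] by (simp add: L2_norm_def)
  qed
  then show ?thesis by (simp add: LIM_zero_iff)
qed

lemma L2_tendsto_square:
  assumes X: "\<And>n. X n \<in> L2 M" and Y: "Y \<in> L2 M"
    and lim: "(\<lambda>n. \<integral>x. (X n x - Y x)\<^sup>2 \<partial>M) \<longlonglongrightarrow> 0"
  shows "(\<lambda>n. \<integral>x. (X n x)\<^sup>2 \<partial>M) \<longlonglongrightarrow> (\<integral>x. (Y x)\<^sup>2 \<partial>M)"
proof -
  have eq: "(\<integral>x. (X n x)\<^sup>2 \<partial>M) = (\<integral>x. (X n x - Y x)\<^sup>2 \<partial>M) + 2 * (\<integral>x. X n x * Y x \<partial>M) - (\<integral>x. (Y x)\<^sup>2 \<partial>M)" for n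
    using integral_square_combination[OF X[of n] Y, where t = "-1"] by simp
  have "(\<lambda>n. \<integral>x. (X n x)\<^sup>2 \<partial>M) \<longlonglongrightarrow> 0 + 2 * (\<integral>x. Y x * Y x \<partial>M) - (\<integral>x. (Y x)\<^sup>2 \<partial>M)"
    unfolding eq by (intro tendsto_intros lim L2_tendsto_inner[OF X Y Y])
  then show ?thesis by (simp add: power2_eq_square)
qed

text \<open>Completeness of \<open>L\<^sup>2\<close>, for geometric rates. The increments are absolutely summable almost
  everywhere since their \<open>L\<^sup>1\<close>-norms are summable, and Fatou's lemma carries the bounds on the
  increments over to the limit. The almost everywhere convergence is needed to identify the limit
  with \<open>\<delta>(G)\<close>.\<close>

lemma L2_fast_Cauchy_limit:
  assumes "finite_measure M" and X: "\<And>n. X n \<in> L2 M"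
    and c: "0 \<le> c" and fast: "\<And>n m. n \<le> m \<Longrightarrow> (\<integral>x. (X m x - X n x)\<^sup>2 \<partial>M) \<le> (c / 2 ^ n)\<^sup>2"
  obtains Y where "Y \<in> L2 M" "AE x in M. (\<lambda>n. X n x) \<longlonglongrightarrow> Y x"
    "(\<lambda>n. \<integral>x. (X n x - Y x)\<^sup>2 \<partial>M) \<longlonglongrightarrow> 0"
proof -
  interpret finite_measure M by fact
  have [measurable]: "X n \<in> borel_measurable M" for n using X by (auto simp: L2_def)
  let ?d = "\<lambda>n x. \<bar>X (Suc n) x - X n x\<bar>"
  define b where "b = L2_norm M (\<lambda>x. 1)"
  have d: "(\<integral>\<^sup>+x. ennreal (?d n x) \<partial>M) \<le> ennreal (c / 2 ^ n * b)" for n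
  proof -
    have D: "(\<lambda>x. ?d n x) \<in> L2 M" using L2_diff[OF X X, of "Suc n" n] by (simp add: L2_def)
    have "(\<integral>x. ?d n x \<partial>M) \<le> L2_norm M (\<lambda>x. ?d n x) * b"
      using L2_Cauchy_Schwarz[OF D L2_const[OF assms(1), of 1]] by (simp add: b_def)
    also have "L2_norm M (\<lambda>x. ?d n x) \<le> c / 2 ^ n"
      using real_sqrt_le_mono[OF fast[of n "Suc n"]] c by (simp add: L2_norm_def)
    finally have "(\<integral>x. ?d n x \<partial>M) \<le> c / 2 ^ n * b"
      by (simp add: b_def L2_norm_def mult_right_mono)
    then show ?thesis
      by (subst nn_integral_eq_integral[OF L2_integrable[OF assms(1) D]]) (auto intro: ennreal_leI)
  qed
  have "(\<integral>\<^sup>+x. (\<Sum>n. ennreal (?d n x)) \<partial>M) = (\<Sum>n. \<integral>\<^sup>+x. ennreal (?d n x) \<partial>M)"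
    by (rule nn_integral_suminf) measurable
  also have "\<dots> \<le> (\<Sum>n. ennreal (c / 2 ^ n * b))" by (intro suminf_le d) auto
  also have "\<dots> < \<infinity>"
  proof -
    have "summable (\<lambda>n. c * b * (1 / 2) ^ n)" by (intro summable_mult summable_geometric) simp
    then have "summable (\<lambda>n. c / 2 ^ n * b)" by (simp add: power_divide mult_ac)
    moreover have "0 \<le> c / 2 ^ n * b" for n using c by (simp add: b_def L2_norm_def)
    ultimately have "(\<Sum>n. ennreal (c / 2 ^ n * b)) = ennreal (\<Sum>n. c / 2 ^ n * b)"
      by (intro suminf_ennreal2)
    then show ?thesis by (simp only: infinity_ennreal_def ennreal_less_top)
  qed
  finally have "AE x in M. (\<Sum>n. ennreal (?d n x)) \<noteq> \<infinity>"
    by (intro nn_integral_PInf_AE) auto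
  then have conv: "AE x in M. convergent (\<lambda>n. X n x)"
  proof (rule AE_mp, intro AE_I2 impI)
    fix x assume "(\<Sum>n. ennreal (?d n x)) \<noteq> \<infinity>"
    then have "summable (\<lambda>n. ?d n x)" by (intro summable_suminf_not_top) auto
    then have "summable (\<lambda>n. X (Suc n) x - X n x)" by (rule summable_rabs_cancel)
    then have "convergent (\<lambda>n. \<Sum>k<n. X (Suc k) x - X k x)" by (simp add: summable_iff_convergent)
    then have "convergent (\<lambda>n. X n x - X 0 x)" by (simp only: sum_lessThan_telescope[of "\<lambda>k. X k x"])
    then show "convergent (\<lambda>n. X n x)" by (simp add: convergent_diff_const_right_iff)
  qed
  define Y where "Y x = lim (\<lambda>n. X n x)" for x
  have [measurable]: "Y \<in> borel_measurable M" unfolding Y_def by measurable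
  have lim: "AE x in M. (\<lambda>n. X n x) \<longlonglongrightarrow> Y x"
    using conv by (rule AE_mp) (auto simp: Y_def convergent_LIMSEQ_iff)
  have bound: "(\<integral>\<^sup>+x. ennreal ((Y x - X n x)\<^sup>2) \<partial>M) \<le> ennreal ((c / 2 ^ n)\<^sup>2)" for n
  proof -
    have "(\<integral>\<^sup>+x. ennreal ((Y x - X n x)\<^sup>2) \<partial>M) = (\<integral>\<^sup>+x. liminf (\<lambda>m. ennreal ((X m x - X n x)\<^sup>2)) \<partial>M)"
    proof (rule nn_integral_cong_AE)
      show "AE x in M. ennreal ((Y x - X n x)\<^sup>2) = liminf (\<lambda>m. ennreal ((X m x - X n x)\<^sup>2))"
        using lim
      proof (rule AE_mp, intro AE_I2 impI)
        fix x assume "(\<lambda>m. X m x) \<longlonglongrightarrow> Y x"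
        then have "(\<lambda>m. ennreal ((X m x - X n x)\<^sup>2)) \<longlonglongrightarrow> ennreal ((Y x - X n x)\<^sup>2)"
          by (intro tendsto_intros)
        then show "ennreal ((Y x - X n x)\<^sup>2) = liminf (\<lambda>m. ennreal ((X m x - X n x)\<^sup>2))"
          by (intro lim_imp_Liminf[symmetric]) simp_all
      qed
    qed
    also have "\<dots> \<le> liminf (\<lambda>m. \<integral>\<^sup>+x. ennreal ((X m x - X n x)\<^sup>2) \<partial>M)"
      by (rule nn_integral_liminf) measurable
    also have "\<dots> \<le> ennreal ((c / 2 ^ n)\<^sup>2)"
    proof (rule Liminf_le)
      show "\<forall>\<^sub>F m in sequentially. (\<integral>\<^sup>+x. ennreal ((X m x - X n x)\<^sup>2) \<partial>M) \<le> ennreal ((c / 2 ^ n)\<^sup>2)"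
        using eventually_ge_at_top[of n]
      proof eventually_elim
        case (elim m)
        have "integrable M (\<lambda>x. (X m x - X n x)\<^sup>2)" using L2_diff[OF X X] by (simp add: L2_def)
        then show ?case using fast[OF elim] by (simp add: nn_integral_eq_integral ennreal_leI)
      qed
    qed simp
    finally show ?thesis .
  qed
  have D: "(\<lambda>x. Y x - X n x) \<in> L2 M" for n
    using bound[of n] by (auto simp: L2_def intro!: integrableI_nonneg order.strict_trans1[OF bound[of n]])
  have YL: "Y \<in> L2 M" using L2_combination[OF D[of 0] X[of 0], of 1 1] by simp
  have "(\<lambda>n. \<integral>x. (X n x - Y x)\<^sup>2 \<partial>M) \<longlonglongrightarrow> 0"
  proof (rule tendsto_sandwich[OF always_eventually always_eventually tendsto_const])
    show "\<forall>n. 0 \<le> (\<integral>x. (X n x - Y x)\<^sup>2 \<partial>M)" by simp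
    show "\<forall>n. (\<integral>x. (X n x - Y x)\<^sup>2 \<partial>M) \<le> (c * (1 / 2) ^ n)\<^sup>2"
    proof
      fix n
      have "ennreal (\<integral>x. (Y x - X n x)\<^sup>2 \<partial>M) \<le> ennreal ((c / 2 ^ n)\<^sup>2)"
        using bound[of n] D[of n] by (subst nn_integral_eq_integral[symmetric]) (auto simp: L2_def)
      then show "(\<integral>x. (X n x - Y x)\<^sup>2 \<partial>M) \<le> (c * (1 / 2) ^ n)\<^sup>2"
        by (simp add: power2_commute power_divide)
    qed
    have "(\<lambda>n. (c * (1 / 2) ^ n)\<^sup>2) \<longlonglongrightarrow> (c * 0)\<^sup>2"
      by (intro tendsto_intros LIMSEQ_realpow_zero) auto
    then show "(\<lambda>n. (c * (1 / 2) ^ n)\<^sup>2) \<longlonglongrightarrow> 0" by simp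
  qed
  then show ?thesis using that YL lim by blast
qed

text \<open>Truncate, then recentre. These approximations make the Cauchy-Schwarz bound on the efficiency
  ratio sharp although the influence functions need not be bounded.\<close>

lemma bounded_scores_dense:
  assumes \<rho>: "\<rho> \<in> space (prob_algebra borel)" and \<phi>: "\<phi> \<in> L2 \<rho>" "(\<integral>x. \<phi> x \<partial>\<rho>) = 0"
  obtains h where "\<And>n. h n \<in> bounded_scores \<rho>" "(\<lambda>n. \<integral>x. (h n x - \<phi> x)\<^sup>2 \<partial>\<rho>) \<longlonglongrightarrow> 0"
proof -
  interpret prob_space \<rho> using \<rho> by (simp add: space_prob_algebra)
  have s: "sets \<rho> = sets borel" using \<rho> by (simp add: space_prob_algebra)
  have [measurable]: "\<phi> \<in> borel_measurable \<rho>" and sq: "integrable \<rho> (\<lambda>x. (\<phi> x)\<^sup>2)"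
    using \<phi> by (auto simp: L2_def)
  have int: "integrable \<rho> \<phi>" using L2_integrable[OF finite_measure_axioms \<phi>(1)] .
  define clip where "clip n x = max (- real n) (min (real n) (\<phi> x))" for n x
  have [measurable]: "clip n \<in> borel_measurable \<rho>" for n unfolding clip_def by measurable
  have clip_n: "\<bar>clip n x\<bar> \<le> real n" and clip_phi: "\<bar>clip n x\<bar> \<le> \<bar>\<phi> x\<bar>" "\<bar>clip n x - \<phi> x\<bar> \<le> \<bar>\<phi> x\<bar>" for n x
    by (auto simp: clip_def max_def min_def)
  have clip_lim: "(\<lambda>n. clip n x) \<longlonglongrightarrow> \<phi> x" for x
  proof (rule tendsto_eventually)
    obtain N :: nat where N: "\<bar>\<phi> x\<bar> \<le> real N" using real_arch_simple by blast
    show "\<forall>\<^sub>F n in sequentially. clip n x = \<phi> x"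
      using eventually_ge_at_top[of N]
    proof eventually_elim
      case (elim n)
      then have "\<bar>\<phi> x\<bar> \<le> real n" using N by linarith
      then show ?case by (auto simp: clip_def)
    qed
  qed
  define m where "m n = (\<integral>x. clip n x \<partial>\<rho>)" for n
  have int_clip: "integrable \<rho> (clip n)" for n
    by (rule integrable_const_bound[where B="real n"]) (use clip_n in auto)
  have m_lim: "m \<longlonglongrightarrow> 0"
    unfolding m_def \<phi>(2)[symmetric]
    by (rule integral_dominated_convergence[where w="\<lambda>x. \<bar>\<phi> x\<bar>"]) (use int clip_lim clip_phi in auto)
  define B where "B = (\<integral>x. \<bar>\<phi> x\<bar> \<partial>\<rho>)"
  have mB: "\<bar>m n\<bar> \<le> B" for n
    unfolding m_def B_def using clip_phi int int_clip by (intro abs_integral_le) auto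
  define h where "h n x = clip n x - m n" for n x
  show ?thesis
  proof (rule that[of h])
    fix n
    have "(\<integral>x. h n x \<partial>\<rho>) = 0" using int_clip by (simp add: h_def m_def prob_space)
    moreover have "\<bar>h n x\<bar> \<le> real n + \<bar>m n\<bar>" for x using clip_n[of n x] by (simp add: h_def)
    moreover have "h n \<in> borel_measurable \<rho>" unfolding h_def by measurable
    ultimately show "h n \<in> bounded_scores \<rho>"
      using measurable_cong_sets[OF s refl] by (auto simp: bounded_scores_def)
  next
    have "(\<lambda>n. \<integral>x. (h n x - \<phi> x)\<^sup>2 \<partial>\<rho>) \<longlonglongrightarrow> (\<integral>x. 0 \<partial>\<rho>)"
    proof (rule integral_dominated_convergence[where w="\<lambda>x. 2 * (\<phi> x)\<^sup>2 + 2 * B\<^sup>2"])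
      show "AE x in \<rho>. (\<lambda>n. (h n x - \<phi> x)\<^sup>2) \<longlonglongrightarrow> 0"
      proof (rule AE_I2)
        fix x
        have "(\<lambda>n. (h n x - \<phi> x)\<^sup>2) \<longlonglongrightarrow> (\<phi> x - 0 - \<phi> x)\<^sup>2"
          unfolding h_def by (intro tendsto_intros clip_lim m_lim)
        then show "(\<lambda>n. (h n x - \<phi> x)\<^sup>2) \<longlonglongrightarrow> 0" by simp
      qed
      fix n
      show "AE x in \<rho>. norm ((h n x - \<phi> x)\<^sup>2) \<le> 2 * (\<phi> x)\<^sup>2 + 2 * B\<^sup>2"
      proof (rule AE_I2)
        fix x
        have "\<bar>h n x - \<phi> x\<bar> \<le> \<bar>\<phi> x\<bar> + B"
          using clip_phi(2)[of n x] mB[of n] by (simp add: h_def)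
        then have "\<bar>h n x - \<phi> x\<bar>\<^sup>2 \<le> (\<bar>\<phi> x\<bar> + B)\<^sup>2" by (intro power_mono) auto
        also have "\<dots> \<le> 2 * (\<phi> x)\<^sup>2 + 2 * B\<^sup>2"
          using sum_squares_bound[of "\<bar>\<phi> x\<bar>" B] by (simp add: power2_sum)
        finally show "norm ((h n x - \<phi> x)\<^sup>2) \<le> 2 * (\<phi> x)\<^sup>2 + 2 * B\<^sup>2" by simp
      qed
    qed (use sq in \<open>auto simp: h_def\<close>)
    then show "(\<lambda>n. \<integral>x. (h n x - \<phi> x)\<^sup>2 \<partial>\<rho>) \<longlonglongrightarrow> 0" by simp
  qed
qed

section \<open>Centred Gaussian variables in a small ball\<close>

lemma gaussian_law_cases:
  assumes "prob_space M" "X \<in> borel_measurable M" "gaussian_law (distr M borel X)" "(\<integral>w. X w \<partial>M) = 0"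
  obtains "AE w in M. X w = 0"
  | \<sigma> where "0 < \<sigma>" "distributed M lborel X (normal_density 0 \<sigma>)"
proof -
  interpret prob_space M by fact
  consider m where "distr M borel X = return borel m"
    | m \<sigma> where "0 < \<sigma>" "distr M borel X = density lborel (normal_density m \<sigma>)"
    using assms(3) unfolding gaussian_law_def by blast
  then show ?thesis
  proof cases
    case (1 m)
    have "AE x in distr M borel X. x = m" unfolding 1 by (simp add: AE_return)
    then have *: "AE w in M. X w = m" by (subst (asm) AE_distr_iff) (use assms in auto)
    then have "(\<integral>w. X w \<partial>M) = (\<integral>w. m \<partial>M)" using assms(2) by (intro integral_cong_AE) auto
    then have "m = 0" using assms(4) by (simp add: prob_space)
    then show ?thesis using * that(1) by simp
  next
    case (2 m \<sigma>)
    have D: "distributed M lborel X (normal_density m \<sigma>)"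
      unfolding distributed_def using 2(2) assms(2) by (auto cong: distr_cong simp: distr_cong[of M M lborel borel X X])
    then have "m = 0" using normal_distributed_expectation[OF 2(1) D] assms(4) by simp
    then show ?thesis using 2(1) D that(2) by simp
  qed
qed

lemma gaussian_law_L2:
  assumes "prob_space M" "X \<in> borel_measurable M" "gaussian_law (distr M borel X)" "(\<integral>w. X w \<partial>M) = 0"
  shows "X \<in> L2 M"
  using assms
proof (cases rule: gaussian_law_cases)
  case 1
  then have "integrable M (\<lambda>w. (X w)\<^sup>2) \<longleftrightarrow> integrable M (\<lambda>w. 0 :: real)"
    using assms(2) by (intro integrable_cong_AE) auto
  then show ?thesis using assms(2) by (simp add: L2_def)
next
  case (2 \<sigma>)
  have "integrable lborel (\<lambda>x. normal_density 0 \<sigma> x * x\<^sup>2)"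
    using integrable_normal_moment[OF 2(1), of 0 2] by simp
  then have "integrable M (\<lambda>w. (X w)\<^sup>2)"
    using distributed_integrable[OF 2(2), of "\<lambda>x. x\<^sup>2"] by simp
  then show ?thesis using assms(2) by (simp add: L2_def)
qed

text \<open>A centred normal density with standard deviation \<open>\<sigma>\<close> is at most \<open>1/(2\<sigma>)\<close>, so the
  interval \<open>[-\<eta>,\<eta>]\<close> has mass at most \<open>\<eta>/\<sigma>\<close>; mass \<open>1/2\<close> forces
  \<open>\<sigma> \<le> 2\<eta>\<close>. For Gaussian variables, closeness in probability is thus
  closeness in \<open>L\<^sup>2\<close>, and no integrability of the supremum of the process has to be proved.\<close>

lemma gaussian_small_ball:
  assumes M: "prob_space M" and X: "X \<in> borel_measurable M"
    and G: "gaussian_law (distr M borel X)" "(\<integral>w. X w \<partial>M) = 0"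
    and \<eta>: "0 \<le> \<eta>" and half: "1 / 2 \<le> measure M {w\<in>space M. \<bar>X w\<bar> \<le> \<eta>}"
  shows "(\<integral>w. (X w)\<^sup>2 \<partial>M) \<le> (2 * \<eta>)\<^sup>2"
  using M X G
proof (cases rule: gaussian_law_cases)
  case 1
  then have "(\<integral>w. (X w)\<^sup>2 \<partial>M) = (\<integral>w. 0 \<partial>M)" using X by (intro integral_cong_AE) auto
  then show ?thesis by simp
next
  case (2 \<sigma>)
  interpret prob_space M by fact
  have "ennreal (measure M {w\<in>space M. \<bar>X w\<bar> \<le> \<eta>}) = emeasure M (X -` {-\<eta>..\<eta>} \<inter> space M)"
    unfolding emeasure_eq_measure by (intro arg_cong[where f="\<lambda>A. ennreal (measure M A)"]) auto
  also have "\<dots> = (\<integral>\<^sup>+x. ennreal (normal_density 0 \<sigma> x) * indicator {-\<eta>..\<eta>} x \<partial>lborel)"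
    by (rule distributed_emeasure[OF 2(2)]) simp
  also have "\<dots> \<le> (\<integral>\<^sup>+x. ennreal (1 / (2 * \<sigma>)) * indicator {-\<eta>..\<eta>} x \<partial>lborel)"
  proof (intro nn_integral_mono mult_right_mono ennreal_leI)
    fix x :: real
    have "2 * \<sigma> \<le> sqrt (2 * pi * \<sigma>\<^sup>2)"
      using pi_gt3 2(1) by (intro real_le_rsqrt) (simp add: power2_eq_square)
    then have "1 / sqrt (2 * pi * \<sigma>\<^sup>2) \<le> 1 / (2 * \<sigma>)" using 2(1) by (intro divide_left_mono) auto
    moreover have "exp (- (x - 0)\<^sup>2 / (2 * \<sigma>\<^sup>2)) \<le> 1" by simp
    ultimately have "1 / sqrt (2 * pi * \<sigma>\<^sup>2) * exp (- (x - 0)\<^sup>2 / (2 * \<sigma>\<^sup>2)) \<le> 1 / (2 * \<sigma>) * 1"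
      using 2(1) by (intro mult_mono) auto
    then show "normal_density 0 \<sigma> x \<le> 1 / (2 * \<sigma>)" unfolding normal_density_def by simp
  qed simp
  also have "\<dots> = ennreal (1 / (2 * \<sigma>)) * ennreal (2 * \<eta>)"
    using \<eta> by (subst nn_integral_cmult_indicator) auto
  also have "\<dots> = ennreal (\<eta> / \<sigma>)" using \<eta> 2(1) by (simp flip: ennreal_mult)
  finally have "measure M {w\<in>space M. \<bar>X w\<bar> \<le> \<eta>} \<le> \<eta> / \<sigma>" using \<eta> 2(1) by simp
  then have "1 / 2 \<le> \<eta> / \<sigma>" using half by linarith
  then have "\<sigma> \<le> 2 * \<eta>" using 2(1) by (simp add: field_simps)
  moreover have "(\<integral>w. (X w)\<^sup>2 \<partial>M) = \<sigma>\<^sup>2"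
    using normal_distributed_variance[OF 2] G(2) by simp
  ultimately show ?thesis using 2(1) power_mono[of \<sigma> "2 * \<eta>" 2] by simp
qed

section \<open>The influence function of a functional of a Brownian bridge\<close>

definition centered :: "'b measure \<Rightarrow> ('b \<Rightarrow> real) \<Rightarrow> 'b \<Rightarrow> real" where
  "centered \<mu> f = (\<lambda>x. f x - (\<integral>y. f y \<partial>\<mu>))"

lemma centered_L2:
  assumes "finite_measure \<mu>" "f \<in> L2 \<mu>"
  shows "centered \<mu> f \<in> L2 \<mu>"
  unfolding centered_def using L2_diff[OF assms(2) L2_const[OF assms(1)]] .

lemma centered_mean:
  assumes "prob_space \<mu>" "integrable \<mu> f"
  shows "(\<integral>x. centered \<mu> f x \<partial>\<mu>) = 0"
proof -
  interpret prob_space \<mu> by fact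
  show ?thesis using assms(2) by (simp add: centered_def prob_space)
qed

lemma square_integral_sum:
  assumes "finite A" "\<And>i. i \<in> A \<Longrightarrow> u i \<in> L2 M"
  shows "(\<integral>x. (\<Sum>i\<in>A. c i * u i x)\<^sup>2 \<partial>M) = (\<Sum>i\<in>A. \<Sum>j\<in>A. c i * c j * (\<integral>x. u i x * u j x \<partial>M))"
proof -
  have *: "(\<Sum>i\<in>A. c i * u i x)\<^sup>2 = (\<Sum>i\<in>A. \<Sum>j\<in>A. c i * c j * (u i x * u j x))" for x
    unfolding power2_eq_square sum_product by (intro sum.cong refl) (simp add: mult_ac)
  have "integrable M (\<lambda>x. u i x * u j x)" if "i \<in> A" "j \<in> A" for i j
    using L2_mult_integrable assms(2) that by blast
  then show ?thesis unfolding * by simp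
qed

locale bridge =
  fixes F :: "('a::topological_space \<Rightarrow> real) set" and \<mu> :: "'a measure"
    and M :: "'w measure" and G :: "'w \<Rightarrow> ('a \<Rightarrow> real) \<Rightarrow> real"
  assumes F_borel: "F \<subseteq> borel_measurable borel"
    and \<mu>_prob: "\<mu> \<in> space (prob_algebra borel)"
    and bridge: "brownian_bridge F \<mu> M G"
begin

lemma prob_mu: "prob_space \<mu>" and sets_mu [measurable_cong]: "sets \<mu> = sets borel"
  using \<mu>_prob by (auto simp: space_prob_algebra)

sublocale mu: prob_space \<mu> by (rule prob_mu)
sublocale M: prob_space M using bridge by (simp add: brownian_bridge_def gaussian_process_def)

lemma F_L2: "f \<in> F \<Longrightarrow> f \<in> L2 \<mu>"
  using bridge F_borel measurable_cong_sets[OF sets_mu refl] by (auto simp: L2_def brownian_bridge_def)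

lemma G_measurable: "f \<in> F \<Longrightarrow> (\<lambda>w. G w f) \<in> borel_measurable M"
  using bridge by (simp add: brownian_bridge_def gaussian_process_def)

lemma G_linf: "w \<in> space M \<Longrightarrow> G w \<in> mspace (linf F)"
proof -
  assume w: "w \<in> space M"
  have "{U. openin (mtopology_of (linf F)) U} \<subseteq> Pow (mspace (linf F))"
    using openin_subset topspace_mtopology_of by fastforce
  then have "space (linf_borel F) = mspace (linf F)"
    unfolding linf_borel_def by (rule space_measure_of)
  moreover have "G \<in> M \<rightarrow>\<^sub>M linf_borel F"
    using bridge by (simp add: brownian_bridge_def tight_in_linf_def)
  ultimately show ?thesis using measurable_space[OF _ w, of G "linf_borel F"] by simp
qed

lemma G_gaussian: "finite A \<Longrightarrow> A \<subseteq> F \<Longrightarrow> gaussian_law (distr M borel (\<lambda>w. \<Sum>f\<in>A. c f * G w f))"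
  using bridge by (simp add: brownian_bridge_def gaussian_process_def)

lemma G_mean: "f \<in> F \<Longrightarrow> (\<integral>w. G w f \<partial>M) = 0"
  using bridge by (simp add: brownian_bridge_def)

lemma G_L2: assumes "f \<in> F" shows "(\<lambda>w. G w f) \<in> L2 M"
proof (rule gaussian_law_L2)
  show "gaussian_law (distr M borel (\<lambda>w. G w f))"
    using G_gaussian[of "{f}" "\<lambda>_. 1"] assms by simp
qed (use assms G_measurable G_mean M.prob_space_axioms in auto)

lemma G_covariance:
  assumes "f \<in> F" "g \<in> F"
  shows "(\<integral>w. G w f * G w g \<partial>M) = (\<integral>x. centered \<mu> f x * centered \<mu> g x \<partial>\<mu>)"
proof -
  have "covariance M (\<lambda>w. G w f) (\<lambda>w. G w g) = covariance \<mu> f g"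
    using bridge assms by (simp add: brownian_bridge_def)
  then show ?thesis using assms by (simp add: covariance_def G_mean centered_def)
qed

text \<open>Equality of covariances makes \<open>f - \<mu>f \<mapsto> G(f)\<close> an isometry of the linear spans in
  \<open>L\<^sup>2(\<mu>)\<close> and \<open>L\<^sup>2(M)\<close>.\<close>

lemma isometry:
  assumes "finite A" "A \<subseteq> F"
  shows "(\<integral>w. (\<Sum>f\<in>A. c f * G w f)\<^sup>2 \<partial>M) = (\<integral>x. (\<Sum>f\<in>A. c f * centered \<mu> f x)\<^sup>2 \<partial>\<mu>)"
proof -
  have "(\<integral>w. (\<Sum>f\<in>A. c f * G w f)\<^sup>2 \<partial>M) = (\<Sum>f\<in>A. \<Sum>g\<in>A. c f * c g * (\<integral>w. G w f * G w g \<partial>M))"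
    using assms G_L2 by (intro square_integral_sum) auto
  also have "\<dots> = (\<Sum>f\<in>A. \<Sum>g\<in>A. c f * c g * (\<integral>x. centered \<mu> f x * centered \<mu> g x \<partial>\<mu>))"
    using assms by (intro sum.cong refl arg_cong2[where f="(*)"] G_covariance) auto
  also have "\<dots> = (\<integral>x. (\<Sum>f\<in>A. c f * centered \<mu> f x)\<^sup>2 \<partial>\<mu>)"
    using assms F_L2 centered_L2[OF mu.finite_measure_axioms]
    by (intro square_integral_sum[symmetric]) auto
  finally show ?thesis .
qed

lemma small_ball:
  assumes A: "finite A" "A \<subseteq> F" and "0 \<le> \<eta>" "B \<in> sets M" "1 / 2 \<le> measure M B"
    and le: "\<And>w. w \<in> B \<Longrightarrow> \<bar>\<Sum>f\<in>A. c f * G w f\<bar> \<le> \<eta>"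
  shows "(\<integral>w. (\<Sum>f\<in>A. c f * G w f)\<^sup>2 \<partial>M) \<le> (2 * \<eta>)\<^sup>2"
proof (rule gaussian_small_ball)
  show meas: "(\<lambda>w. \<Sum>f\<in>A. c f * G w f) \<in> borel_measurable M"
    using A G_measurable by (intro borel_measurable_sum borel_measurable_times) auto
  show "(\<integral>w. (\<Sum>f\<in>A. c f * G w f) \<partial>M) = 0"
    using A G_mean L2_integrable[OF M.finite_measure_axioms G_L2]
    by (subst Bochner_Integration.integral_sum) (auto intro!: sum.neutral simp: subset_iff)
  have "measure M B \<le> measure M {w \<in> space M. \<bar>\<Sum>f\<in>A. c f * G w f\<bar> \<le> \<eta>}"
    using assms(4) le sets.sets_into_space meas by (intro M.finite_measure_mono) auto
  then show "1 / 2 \<le> measure M {w \<in> space M. \<bar>\<Sum>f\<in>A. c f * G w f\<bar> \<le> \<eta>}"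
    using assms(5) by linarith
qed (use assms G_gaussian M.prob_space_axioms in auto)

text \<open>Tightness supplies the compact set to discretise. The event is measurable because its measure,
  being positive, is not the default value 0 given to a non-measurable set.\<close>

lemma finite_dimensional_approximation:
  fixes \<eta> e :: real
  assumes "0 < \<eta>" "0 < e" "e < 1"
  obtains \<pi> B where "\<pi> \<in> F \<rightarrow> F" "finite (\<pi> ` F)" "B \<in> sets M" "1 - e \<le> measure M B"
    "\<And>w f. w \<in> B \<Longrightarrow> f \<in> F \<Longrightarrow> \<bar>G w f - G w (\<pi> f)\<bar> \<le> \<eta>"
proof -
  obtain K where K: "compactin (mtopology_of (linf F)) K" "1 - e \<le> measure M {w\<in>space M. G w \<in> K}"
    using bridge assms(2) unfolding brownian_bridge_def tight_in_linf_def by blast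
  have "{w\<in>space M. G w \<in> K} \<in> sets M"
    using K(2) assms(3) measure_notin_sets[of "{w\<in>space M. G w \<in> K}" M] by fastforce
  moreover obtain \<pi> where "\<pi> \<in> F \<rightarrow> F" "finite (\<pi> ` F)"
    "\<And>u f. u \<in> K \<Longrightarrow> f \<in> F \<Longrightarrow> \<bar>u f - u (\<pi> f)\<bar> \<le> \<eta>"
    using linf_compact_finite_range[OF K(1) assms(1)] by blast
  ultimately show ?thesis using that[of \<pi> "{w\<in>space M. G w \<in> K}"] K(2) by blast
qed

text \<open>The function \<open>\<phi>\<close> is the preimage of \<open>\<delta>(G)\<close> under the isometry
  \<open>f - \<mu>f \<mapsto> G(f)\<close>, extended to closures. The discretisations \<open>\<pi>\<^sub>n\<close> of the process
  give finite sums \<open>L\<^sub>n = \<delta>(G \<circ> \<pi>\<^sub>n)\<close> that are within a constant times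
  \<open>2\<^sup>-\<^sup>n\<close> of \<open>\<delta>(G)\<close> with probability at least \<open>1 - 2\<^sup>-\<^sup>n/4\<close>. By the small ball estimate
  they converge in \<open>L\<^sup>2(M)\<close> at a geometric rate, and by Borel-Cantelli the limit is
  \<open>\<delta>(G)\<close>. Their preimages \<open>\<phi>\<^sub>n\<close> converge at the same rate, to \<open>\<phi>\<close>; this gives the
  mean and the variance.

  The pairing \<open>\<integral>\<phi>\<^sub>n h d\<mu>\<close> equals \<open>\<delta>((h\<mu>) \<circ> \<pi>\<^sub>n)\<close>. The small ball estimate also bounds
  \<open>f - \<pi>\<^sub>n f\<close>, centred, in \<open>L\<^sup>2(\<mu>)\<close> uniformly in \<open>f\<close>. Hence
  \<open>(h\<mu>) \<circ> \<pi>\<^sub>n\<close> tends to \<open>h\<mu>\<close> uniformly on \<open>F\<close>, by the Cauchy-Schwarz inequality, and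
  the formula for \<open>\<integral>\<phi>h d\<mu>\<close> follows.\<close>

lemma influence_function:
  assumes \<delta>: "linf_dual F \<delta>" and E: "envelope E F" "integrable \<mu> E"
  obtains \<phi> where "\<phi> \<in> L2 \<mu>" "(\<integral>x. \<phi> x \<partial>\<mu>) = 0"
    "(\<integral>x. (\<phi> x)\<^sup>2 \<partial>\<mu>) = M.variance (\<lambda>w. \<delta> (G w))"
    "\<And>h. h \<in> bounded_scores \<mu> \<Longrightarrow> (\<integral>x. \<phi> x * h x \<partial>\<mu>) = \<delta> (weighted F h \<mu>)"
proof -
  obtain C where C: "0 < C"
    "\<And>u v r. \<lbrakk>u \<in> mspace (linf F); v \<in> mspace (linf F); 0 < r; \<And>f. f \<in> F \<Longrightarrow> \<bar>u f - v f\<bar> \<le> r\<rbrakk>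
       \<Longrightarrow> \<bar>\<delta> u - \<delta> v\<bar> \<le> C * r"
    using linf_dual_Lipschitz[OF \<delta>] by blast
  define \<eta> :: "nat \<Rightarrow> real" where "\<eta> n = (1 / 2) ^ n" for n
  have \<eta>0: "0 < \<eta> n" and \<eta>1: "\<eta> n \<le> 1" and \<eta>_mono: "n \<le> m \<Longrightarrow> \<eta> m \<le> \<eta> n" for n m
    by (auto simp: \<eta>_def power_decreasing power_le_one)
  have \<eta>_lim: "\<eta> \<longlonglongrightarrow> 0" unfolding \<eta>_def by (rule LIMSEQ_realpow_zero) auto
  have "\<exists>\<pi> B. \<pi> \<in> F \<rightarrow> F \<and> finite (\<pi> ` F) \<and> B \<in> sets M \<and> 1 - \<eta> n / 4 \<le> measure M B \<and>
      (\<forall>w\<in>B. \<forall>f\<in>F. \<bar>G w f - G w (\<pi> f)\<bar> \<le> \<eta> n)" for n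
  proof -
    have "0 < \<eta> n / 4" "\<eta> n / 4 < 1" using \<eta>0[of n] \<eta>1[of n] by auto
    then show ?thesis using finite_dimensional_approximation[OF \<eta>0] by (metis (full_types))
  qed
  then obtain \<pi> B where \<pi>: "\<pi> n \<in> F \<rightarrow> F" "finite (\<pi> n ` F)" and B: "B n \<in> sets M" "1 - \<eta> n / 4 \<le> measure M (B n)"
    and close: "\<And>w f. w \<in> B n \<Longrightarrow> f \<in> F \<Longrightarrow> \<bar>G w f - G w (\<pi> n f)\<bar> \<le> \<eta> n" for n
    by metis
  define A where "A n = \<pi> n ` F" for n
  have A: "finite (A n)" "A n \<subseteq> F" for n using \<pi>[of n] by (auto simp: A_def)
  define c where "c n g = (if g \<in> A n then \<delta> (\<lambda>f\<in>F. of_bool (\<pi> n f = g)) else 0)" for n g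
  have fin_range: "\<delta> (\<lambda>f\<in>F. u (\<pi> n f)) = (\<Sum>g\<in>A n. c n g * u g)" for n u
    using linf_dual_finite_range[OF \<delta> \<pi>, of u n] by (simp add: A_def c_def)
  define L where "L n w = (\<Sum>g\<in>A n. c n g * G w g)" for n w
  define \<phi> where "\<phi> n x = (\<Sum>g\<in>A n. c n g * centered \<mu> g x)" for n x
  have L_close: "\<bar>\<delta> (G w) - L n w\<bar> \<le> C * \<eta> n" if "w \<in> B n" for n w
  proof -
    have "w \<in> space M" using that B(1) sets.sets_into_space by blast
    then have u: "G w \<in> mspace (linf F)" by (rule G_linf)
    show ?thesis unfolding L_def fin_range[symmetric]
      using close[OF that] by (intro C(2) u linf_comp[OF u] \<pi> \<eta>0) auto
  qed
  \<comment> \<open>coefficients vanish off their own index set, so two sums merge over the union\<close>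
  have widen: "(\<Sum>g\<in>A n \<union> A m. (c m g - c n g) * v g) = (\<Sum>g\<in>A m. c m g * v g) - (\<Sum>g\<in>A n. c n g * v g)"
    for n m and v :: "('a \<Rightarrow> real) \<Rightarrow> real"
  proof -
    have "(\<Sum>g\<in>A m. c m g * v g) = (\<Sum>g\<in>A n \<union> A m. c m g * v g)"
      by (rule sum.mono_neutral_left) (use A in \<open>auto simp: c_def\<close>)
    moreover have "(\<Sum>g\<in>A n. c n g * v g) = (\<Sum>g\<in>A n \<union> A m. c n g * v g)"
      by (rule sum.mono_neutral_left) (use A in \<open>auto simp: c_def\<close>)
    ultimately show ?thesis by (simp add: left_diff_distrib sum_subtractf)
  qed
  have fast: "(\<integral>w. (L m w - L n w)\<^sup>2 \<partial>M) \<le> (4 * C / 2 ^ n)\<^sup>2"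
    and same: "(\<integral>w. (L m w - L n w)\<^sup>2 \<partial>M) = (\<integral>x. (\<phi> m x - \<phi> n x)\<^sup>2 \<partial>\<mu>)" if "n \<le> m" for n m
  proof -
    have AA: "finite (A n \<union> A m)" "A n \<union> A m \<subseteq> F" using A by auto
    show "(\<integral>w. (L m w - L n w)\<^sup>2 \<partial>M) = (\<integral>x. (\<phi> m x - \<phi> n x)\<^sup>2 \<partial>\<mu>)"
      using isometry[OF AA, of "\<lambda>g. c m g - c n g"] unfolding widen L_def \<phi>_def .
    have "measure M (space M - B n \<inter> B m) \<le> measure M ((space M - B n) \<union> (space M - B m))"
      using B by (intro M.finite_measure_mono) auto
    also have "\<dots> \<le> measure M (space M - B n) + measure M (space M - B m)"
      using B by (intro measure_Un_le) auto
    also have "\<dots> \<le> 1 / 2"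
      using B(2)[of n] B(2)[of m] \<eta>1[of n] \<eta>1[of m] M.prob_compl[OF B(1)] by simp
    \<comment> \<open>at most a quarter of the mass is lost at each stage\<close>
    finally have half: "1 / 2 \<le> measure M (B n \<inter> B m)" using M.prob_compl[of "B n \<inter> B m"] B by auto
    have "\<bar>L m w - L n w\<bar> \<le> 2 * (C * \<eta> n)" if "w \<in> B n \<inter> B m" for w
    proof -
      have "C * \<eta> m \<le> C * \<eta> n" using \<eta>_mono[OF \<open>n \<le> m\<close>] C(1) by simp
      then show ?thesis using L_close[of w n] L_close[of w m] that by auto
    qed
    then have "(\<integral>w. (L m w - L n w)\<^sup>2 \<partial>M) \<le> (2 * (2 * (C * \<eta> n)))\<^sup>2"
      using small_ball[OF AA _ _ half, of "2 * (C * \<eta> n)" "\<lambda>g. c m g - c n g"] C(1) \<eta>0[of n] B(1)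
      unfolding widen L_def by simp
    then show "(\<integral>w. (L m w - L n w)\<^sup>2 \<partial>M) \<le> (4 * C / 2 ^ n)\<^sup>2"
      by (simp add: \<eta>_def power_divide mult_ac)
  qed
  have fast': "(\<integral>x. (\<phi> m x - \<phi> n x)\<^sup>2 \<partial>\<mu>) \<le> (4 * C / 2 ^ n)\<^sup>2" if "n \<le> m" for n m
    using fast[OF that] same[OF that] by simp
  have L_L2: "L n \<in> L2 M" for n
    unfolding L_def by (rule L2_sum) (use A G_L2 in auto)
  have \<phi>_L2: "\<phi> n \<in> L2 \<mu>" for n
    unfolding \<phi>_def by (rule L2_sum) (use A(2) F_L2 centered_L2[OF mu.finite_measure_axioms] in blast)
  have "0 \<le> 4 * C" using C by simp
  obtain Linf where Linf: "Linf \<in> L2 M" "AE w in M. (\<lambda>n. L n w) \<longlonglongrightarrow> Linf w"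
    "(\<lambda>n. \<integral>w. (L n w - Linf w)\<^sup>2 \<partial>M) \<longlonglongrightarrow> 0"
    using L2_fast_Cauchy_limit[OF M.finite_measure_axioms L_L2 \<open>0 \<le> 4 * C\<close> fast] by blast
  obtain \<psi> where \<psi>: "\<psi> \<in> L2 \<mu>" "(\<lambda>n. \<integral>x. (\<phi> n x - \<psi> x)\<^sup>2 \<partial>\<mu>) \<longlonglongrightarrow> 0"
    using L2_fast_Cauchy_limit[OF mu.finite_measure_axioms \<phi>_L2 \<open>0 \<le> 4 * C\<close> fast'] by blast
  have AE_eq: "AE w in M. \<delta> (G w) = Linf w"
  proof -
    have "AE w in M. \<forall>\<^sub>F n in sequentially. w \<in> space M - (space M - B n)"
    proof (rule borel_cantelli_AE1)
      show "summable (\<lambda>n. measure M (space M - B n))"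
      proof (rule summable_comparison_test)
        show "\<exists>N. \<forall>n\<ge>N. norm (measure M (space M - B n)) \<le> \<eta> n"
        proof (intro exI[of _ 0] allI impI)
          fix n show "norm (measure M (space M - B n)) \<le> \<eta> n"
            using B(2)[of n] M.prob_compl[OF B(1)] \<eta>0[of n] by simp
        qed
        show "summable \<eta>" unfolding \<eta>_def by (rule summable_geometric) simp
      qed
    qed (use B in \<open>auto simp: M.emeasure_eq_measure\<close>)
    then show ?thesis using Linf(2)
    proof eventually_elim
      case (elim w)
      have "(\<lambda>n. L n w - \<delta> (G w)) \<longlonglongrightarrow> 0"
      proof (rule Lim_null_comparison)
        show "\<forall>\<^sub>F n in sequentially. norm (L n w - \<delta> (G w)) \<le> C * \<eta> n"
          using elim(1) by eventually_elim (use L_close in \<open>auto simp: abs_minus_commute\<close>)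
        show "(\<lambda>n. C * \<eta> n) \<longlonglongrightarrow> 0" using tendsto_mult_right_zero[OF \<eta>_lim] .
      qed
      then have "(\<lambda>n. L n w) \<longlonglongrightarrow> \<delta> (G w)" by (simp add: LIM_zero_iff)
      then show ?case using elim(2) LIMSEQ_unique by blast
    qed
  qed
  have \<delta>G [measurable]: "(\<lambda>w. \<delta> (G w)) \<in> borel_measurable M"
    using measurable_compose[OF _ linf_dual_measurable[OF \<delta>]] bridge
    by (auto simp: brownian_bridge_def tight_in_linf_def)
  have Linf_meas [measurable]: "Linf \<in> borel_measurable M" using Linf(1) by (simp add: L2_def)
  have one: "(\<lambda>w. 1) \<in> L2 M" "(\<lambda>x. 1) \<in> L2 \<mu>"
    by (rule L2_const[OF M.finite_measure_axioms], rule L2_const[OF mu.finite_measure_axioms])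
  have "(\<integral>w. L n w \<partial>M) = 0" for n
    unfolding L_def using A G_mean L2_integrable[OF M.finite_measure_axioms G_L2]
    by (subst Bochner_Integration.integral_sum) (auto intro!: sum.neutral simp: subset_iff)
  then have Linf_mean: "(\<integral>w. Linf w \<partial>M) = 0"
    using L2_tendsto_inner[OF L_L2 Linf(1) one(1) Linf(3)] by (auto simp: LIMSEQ_const_iff)
  have "(\<integral>x. \<phi> n x \<partial>\<mu>) = 0" for n
    unfolding \<phi>_def using A centered_mean[OF prob_mu] L2_integrable[OF mu.finite_measure_axioms]
      F_L2 centered_L2[OF mu.finite_measure_axioms]
    by (subst Bochner_Integration.integral_sum) (auto intro!: sum.neutral simp: subset_iff)
  then have mean: "(\<integral>x. \<psi> x \<partial>\<mu>) = 0"
    using L2_tendsto_inner[OF \<phi>_L2 \<psi>(1) one(2) \<psi>(2)] by (auto simp: LIMSEQ_const_iff)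
  have "(\<integral>w. (L n w)\<^sup>2 \<partial>M) = (\<integral>x. (\<phi> n x)\<^sup>2 \<partial>\<mu>)" for n
    unfolding L_def \<phi>_def using A by (rule isometry)
  then have "(\<lambda>n. \<integral>x. (\<phi> n x)\<^sup>2 \<partial>\<mu>) \<longlonglongrightarrow> (\<integral>w. (Linf w)\<^sup>2 \<partial>M)"
    using L2_tendsto_square[OF L_L2 Linf(1,3)] by simp
  then have sq: "(\<integral>w. (Linf w)\<^sup>2 \<partial>M) = (\<integral>x. (\<psi> x)\<^sup>2 \<partial>\<mu>)"
    by (rule LIMSEQ_unique[OF _ L2_tendsto_square[OF \<phi>_L2 \<psi>]])
  have "(\<integral>w. \<delta> (G w) \<partial>M) = (\<integral>w. Linf w \<partial>M)"
    using AE_eq by (intro integral_cong_AE) auto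
  moreover have "(\<integral>w. (\<delta> (G w))\<^sup>2 \<partial>M) = (\<integral>w. (Linf w)\<^sup>2 \<partial>M)"
    using AE_eq by (intro integral_cong_AE) auto
  ultimately have var: "(\<integral>x. (\<psi> x)\<^sup>2 \<partial>\<mu>) = M.variance (\<lambda>w. \<delta> (G w))"
    using Linf_mean sq by simp
  have deriv: "(\<integral>x. \<psi> x * h x \<partial>\<mu>) = \<delta> (weighted F h \<mu>)" if h: "h \<in> bounded_scores \<mu>" for h
  proof -
    obtain b where b: "\<And>x. \<bar>h x\<bar> \<le> b" and hm: "h \<in> borel_measurable borel" and h0: "(\<integral>x. h x \<partial>\<mu>) = 0"
      using h by (auto simp: bounded_scores_def)
    have hm': "h \<in> borel_measurable \<mu>" using hm measurable_cong_sets[OF sets_mu refl] by blast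
    have hL: "h \<in> L2 \<mu>" using L2_bounded[OF mu.finite_measure_axioms hm' b] .
    have cen: "(\<integral>x. centered \<mu> g x * h x \<partial>\<mu>) = (\<integral>x. g x * h x \<partial>\<mu>)" if "g \<in> F" for g
      using L2_mult_integrable[OF F_L2[OF that] hL] L2_integrable[OF mu.finite_measure_axioms hL] h0
      by (simp add: centered_def left_diff_distrib)
    have wL: "weighted F h \<mu> \<in> mspace (linf F)"
      unfolding mspace_linf_iff
    proof (intro conjI exI ballI)
      show "weighted F h \<mu> \<in> extensional F" by (simp add: weighted_def)
      fix f assume f: "f \<in> F"
      have "\<bar>\<integral>x. f x * h x \<partial>\<mu>\<bar> \<le> (\<integral>x. b * E x \<partial>\<mu>)"
      proof (rule abs_integral_le)
        show "integrable \<mu> (\<lambda>x. f x * h x)" using L2_mult_integrable[OF F_L2[OF f] hL] .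
        show "integrable \<mu> (\<lambda>x. b * E x)" using E(2) by simp
        fix x
        have "\<bar>f x\<bar> * \<bar>h x\<bar> \<le> E x * b"
          using b[of x] f E(1) by (intro mult_mono) (auto simp: envelope_def)
        then show "\<bar>f x * h x\<bar> \<le> b * E x" by (simp add: abs_mult mult.commute)
      qed
      then show "\<bar>weighted F h \<mu> f\<bar> \<le> (\<integral>x. b * E x \<partial>\<mu>)" using f by (simp add: weighted_def)
    qed
    \<comment> \<open>one is added because the Lipschitz bound needs a positive radius\<close>
    define k where "k = L2_norm \<mu> h + 1"
    have k: "L2_norm \<mu> h \<le> k" "k > 0" by (auto simp: k_def L2_norm_def add_nonneg_pos)
    have approx: "\<bar>weighted F h \<mu> f - weighted F h \<mu> (\<pi> n f)\<bar> \<le> 2 * \<eta> n * k" if f: "f \<in> F" for f n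
    proof (cases "\<pi> n f = f")
      case True then show ?thesis using \<eta>0[of n] k by simp
    next
      case False
      let ?g = "\<pi> n f"
      have g: "?g \<in> F" using \<pi> f by blast
      let ?c = "\<lambda>j. if j = f then 1 else - 1 :: real"
      let ?d = "\<lambda>x. centered \<mu> f x - centered \<mu> ?g x"
      have fg: "finite {f, ?g}" "{f, ?g} \<subseteq> F" using f g by auto
      have two: "(\<Sum>j\<in>{f, ?g}. ?c j * v j) = v f - v ?g" for v :: "('a \<Rightarrow> real) \<Rightarrow> real"
        using False by auto
      have "(\<integral>w. (G w f - G w ?g)\<^sup>2 \<partial>M) \<le> (2 * \<eta> n)\<^sup>2"
        using small_ball[OF fg, of "\<eta> n" "B n" ?c, unfolded two] close f B[of n] \<eta>0[of n] \<eta>1[of n] by simp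
      then have "(\<integral>x. (?d x)\<^sup>2 \<partial>\<mu>) \<le> (2 * \<eta> n)\<^sup>2"
        using isometry[OF fg, of ?c, unfolded two] by simp
      then have "L2_norm \<mu> ?d \<le> 2 * \<eta> n"
        unfolding L2_norm_def using \<eta>0[of n] by (intro real_le_lsqrt) auto
      moreover have dL: "?d \<in> L2 \<mu>"
        using f g F_L2 centered_L2[OF mu.finite_measure_axioms] by (intro L2_diff) auto
      ultimately have "\<bar>\<integral>x. ?d x * h x \<partial>\<mu>\<bar> \<le> 2 * \<eta> n * k"
        using L2_Cauchy_Schwarz[OF dL hL] k \<eta>0[of n] mult_mono[of "L2_norm \<mu> ?d" "2 * \<eta> n" "L2_norm \<mu> h" k]
        by (simp add: L2_norm_def)
      moreover have "(\<integral>x. ?d x * h x \<partial>\<mu>) = (\<integral>x. centered \<mu> f x * h x \<partial>\<mu>) - (\<integral>x. centered \<mu> ?g x * h x \<partial>\<mu>)"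
        using L2_mult_integrable[OF centered_L2[OF mu.finite_measure_axioms F_L2] hL] f g
        by (simp add: left_diff_distrib)
      ultimately show ?thesis using f g by (simp add: weighted_def cen)
    qed
    have ip: "(\<integral>x. \<phi> n x * h x \<partial>\<mu>) = \<delta> (\<lambda>f\<in>F. weighted F h \<mu> (\<pi> n f))" for n
    proof -
      have "(\<integral>x. \<phi> n x * h x \<partial>\<mu>) = (\<integral>x. (\<Sum>g\<in>A n. c n g * (centered \<mu> g x * h x)) \<partial>\<mu>)"
        by (simp add: \<phi>_def sum_distrib_right mult.assoc)
      also have "\<dots> = (\<Sum>g\<in>A n. c n g * (\<integral>x. centered \<mu> g x * h x \<partial>\<mu>))"
        using L2_mult_integrable[OF centered_L2[OF mu.finite_measure_axioms F_L2] hL] A[of n]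
        by (subst Bochner_Integration.integral_sum) auto
      also have "\<dots> = (\<Sum>g\<in>A n. c n g * weighted F h \<mu> g)"
        using A[of n] by (intro sum.cong refl) (auto simp: cen weighted_def subset_iff)
      finally show ?thesis by (simp add: fin_range)
    qed
    have "(\<lambda>n. (\<integral>x. \<phi> n x * h x \<partial>\<mu>) - \<delta> (weighted F h \<mu>)) \<longlonglongrightarrow> 0"
    proof (rule Lim_null_comparison)
      have "\<bar>\<delta> (weighted F h \<mu>) - \<delta> (\<lambda>f\<in>F. weighted F h \<mu> (\<pi> n f))\<bar> \<le> C * (2 * \<eta> n * k)" for n
        using approx \<eta>0[of n] k by (intro C(2) wL linf_comp[OF wL \<pi>(1)]) auto
      then show "\<forall>\<^sub>F n in sequentially. norm ((\<integral>x. \<phi> n x * h x \<partial>\<mu>) - \<delta> (weighted F h \<mu>)) \<le> C * (2 * \<eta> n * k)"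
        by (intro always_eventually) (simp add: ip abs_minus_commute)
      have "(\<lambda>n. C * (2 * \<eta> n * k)) \<longlonglongrightarrow> C * (2 * 0 * k)" by (intro tendsto_intros \<eta>_lim)
      then show "(\<lambda>n. C * (2 * \<eta> n * k)) \<longlonglongrightarrow> 0" by simp
    qed
    then have "(\<lambda>n. \<integral>x. \<phi> n x * h x \<partial>\<mu>) \<longlonglongrightarrow> \<delta> (weighted F h \<mu>)" by (simp add: LIM_zero_iff)
    then show ?thesis using L2_tendsto_inner[OF \<phi>_L2 \<psi>(1) hL \<psi>(2)] LIMSEQ_unique by blast
  qed
  show ?thesis using that \<psi>(1) mean var deriv by blast
qed

end

section \<open>The Hellinger defect of a path of densities\<close>

lemma measure_sum_density:
  assumes [measurable]: "p \<in> borel_measurable Q"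
  shows "measure_sum (density Q p) Q = density Q (\<lambda>z. p z + 1)"
proof -
  let ?D = "density Q (\<lambda>z. p z + 1)"
  have "emeasure (density Q p) A + emeasure Q A = emeasure ?D A" if A: "A \<in> sets Q" for A
  proof -
    have "emeasure ?D A = (\<integral>\<^sup>+z. p z * indicator A z + indicator A z \<partial>Q)"
      using A by (subst emeasure_density) (auto simp: distrib_right)
    also have "\<dots> = emeasure (density Q p) A + emeasure Q A"
      using A by (subst nn_integral_add) (auto simp: emeasure_density)
    finally show ?thesis by simp
  qed
  then have "measure_sum (density Q p) Q = measure_of (space Q) (sets Q) (emeasure ?D)"
    unfolding measure_sum_def by (intro measure_of_eq sets.space_closed) (simp add: sets.sigma_sets_eq)
  also have "\<dots> = measure_of (space ?D) (sets ?D) (emeasure ?D)" by simp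
  also have "\<dots> = ?D" by (rule measure_of_of_measure)
  finally show ?thesis .
qed

text \<open>The Hellinger integral does not depend on the dominating measure: the density of
  \<open>pQ + Q\<close> with respect to \<open>Q\<close> is \<open>1 + p\<close>, the two Radon-Nikodym derivatives are
  \<open>p/(1+p)\<close> and \<open>1/(1+p)\<close>, and the factor \<open>1 + p\<close> cancels.\<close>

lemma score_defect_density:
  assumes Q: "finite_measure Q" and p [measurable]: "p \<in> borel_measurable Q"
    and p0: "\<And>z. 0 \<le> p z" and pB: "\<And>z. p z \<le> B" and h [measurable]: "h \<in> borel_measurable Q"
  shows "score_defect Q (density Q (\<lambda>z. ennreal (p z))) h t =
    (\<integral>\<^sup>+z. ennreal (((sqrt (p z) - 1) / t - h z / 2)\<^sup>2) \<partial>Q)"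
proof -
  interpret Q: finite_measure Q by fact
  define D where "D = density Q (\<lambda>z. ennreal (1 + p z))"
  let ?R = "density Q (\<lambda>z. ennreal (p z))"
  have D: "measure_sum ?R Q = D"
    unfolding D_def by (subst measure_sum_density) (use p0 in \<open>auto simp: ennreal_plus add.commute intro!: density_cong\<close>)
  have pos: "0 < 1 + p z" for z using p0[of z] by linarith
  have "emeasure D (space D) = (\<integral>\<^sup>+z. ennreal (1 + p z) \<partial>Q)"
    by (simp add: D_def emeasure_density cong: nn_integral_cong)
  also have "\<dots> \<le> (\<integral>\<^sup>+z. ennreal (1 + B) \<partial>Q)"
    using pB by (intro nn_integral_mono ennreal_leI) auto
  also have "\<dots> < \<infinity>" by (simp add: ennreal_mult_less_top Q.emeasure_eq_measure)
  finally have "finite_measure D" by (intro finite_measureI) auto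
  then interpret D: finite_measure D .
  have R: "density D (\<lambda>z. ennreal (p z / (1 + p z))) = ?R"
  proof -
    have "ennreal (1 + p z) * ennreal (p z / (1 + p z)) = ennreal (p z)" for z
      using pos[of z] p0[of z] by (subst ennreal_mult[symmetric]) auto
    then show ?thesis unfolding D_def by (subst density_density_eq) auto
  qed
  have Q': "density D (\<lambda>z. ennreal (1 / (1 + p z))) = Q"
  proof -
    have "ennreal (1 + p z) * ennreal (1 / (1 + p z)) = 1" for z
      using pos[of z] by (subst ennreal_mult[symmetric]) auto
    then show ?thesis unfolding D_def by (subst density_density_eq) (auto simp: density_1)
  qed
  have RN1: "AE z in D. ennreal (p z / (1 + p z)) = RN_deriv D ?R z"
    by (rule D.RN_deriv_unique[OF _ R]) (simp add: D_def)
  have RN2: "AE z in D. ennreal (1 / (1 + p z)) = RN_deriv D Q z"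
    by (rule D.RN_deriv_unique[OF _ Q']) (simp add: D_def)
  have "score_defect Q ?R h t = (\<integral>\<^sup>+z. ennreal (((sqrt (p z / (1 + p z)) - sqrt (1 / (1 + p z))) / t
        - h z * sqrt (1 / (1 + p z)) / 2)\<^sup>2) \<partial>D)"
    unfolding score_defect_def Let_def D
  proof (rule nn_integral_cong_AE)
    show "AE z in D. ennreal (((sqrt (enn2real (RN_deriv D ?R z)) - sqrt (enn2real (RN_deriv D Q z))) / t
          - h z * sqrt (enn2real (RN_deriv D Q z)) / 2)\<^sup>2)
        = ennreal (((sqrt (p z / (1 + p z)) - sqrt (1 / (1 + p z))) / t - h z * sqrt (1 / (1 + p z)) / 2)\<^sup>2)"
      using RN1 RN2
    proof eventually_elim
      case (elim z)
      have "enn2real (RN_deriv D ?R z) = p z / (1 + p z)" "enn2real (RN_deriv D Q z) = 1 / (1 + p z)"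
        unfolding elim[symmetric] using p0[of z] pos[of z] by simp_all
      then show ?case by simp
    qed
  qed
  also have "\<dots> = (\<integral>\<^sup>+z. ennreal (1 + p z) * ennreal (((sqrt (p z / (1 + p z)) - sqrt (1 / (1 + p z))) / t
        - h z * sqrt (1 / (1 + p z)) / 2)\<^sup>2) \<partial>Q)"
    unfolding D_def by (subst nn_integral_density) auto
  also have "\<dots> = (\<integral>\<^sup>+z. ennreal (((sqrt (p z) - 1) / t - h z / 2)\<^sup>2) \<partial>Q)"
  proof (intro nn_integral_cong)
    fix z
    have s: "sqrt (1 + p z) > 0" using pos[of z] by simp
    have "(sqrt (p z / (1 + p z)) - sqrt (1 / (1 + p z))) / t - h z * sqrt (1 / (1 + p z)) / 2
        = ((sqrt (p z) - 1) / t - h z / 2) / sqrt (1 + p z)"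
      using s by (simp add: real_sqrt_divide diff_divide_distrib mult_ac)
    then have "(1 + p z) * ((sqrt (p z / (1 + p z)) - sqrt (1 / (1 + p z))) / t - h z * sqrt (1 / (1 + p z)) / 2)\<^sup>2
        = ((sqrt (p z) - 1) / t - h z / 2)\<^sup>2"
      using pos[of z] s by (simp add: power_divide)
    then show "ennreal (1 + p z) * ennreal (((sqrt (p z / (1 + p z)) - sqrt (1 / (1 + p z))) / t
        - h z * sqrt (1 / (1 + p z)) / 2)\<^sup>2) = ennreal (((sqrt (p z) - 1) / t - h z / 2)\<^sup>2)"
      using pos[of z] by (simp flip: ennreal_mult)
  qed
  finally show ?thesis .
qed

text \<open>With \<open>r = sqrt(1 + s)\<close> the left side is \<open>(r-1)\<^sup>2/2\<close> and \<open>s\<^sup>2 = (r-1)\<^sup>2 (r+1)\<^sup>2\<close>, so the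
  bound holds up to the endpoint \<open>s = -1\<close>.\<close>

lemma sqrt_linearization:
  fixes s :: real
  assumes "-1 \<le> s"
  shows "\<bar>sqrt (1 + s) - 1 - s / 2\<bar> \<le> s\<^sup>2 / 2"
proof -
  define r where "r = sqrt (1 + s)"
  have r: "0 \<le> r" "s = r\<^sup>2 - 1" using assms by (auto simp: r_def)
  have "sqrt (1 + s) - 1 - s / 2 = - ((r - 1)\<^sup>2 / 2)"
    unfolding r_def[symmetric] r(2) using r(1) by (simp add: power2_eq_square field_simps)
  moreover have "s\<^sup>2 = (r - 1)\<^sup>2 * (r + 1)\<^sup>2"
    unfolding r(2) by (simp add: power2_eq_square algebra_simps)
  moreover have "(r - 1)\<^sup>2 * 1 \<le> (r - 1)\<^sup>2 * (r + 1)\<^sup>2"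
    using r(1) by (intro mult_left_mono) (auto simp: one_le_power)
  ultimately show ?thesis by simp
qed

text \<open>Write the product as \<open>1 + s\<close>. Then \<open>\<bar>s\<bar> \<le> 3tc\<close>, so linearising the root costs
  \<open>9(tc)\<^sup>2/2\<close>, and the cross term \<open>t\<^sup>2ab\<close> costs another \<open>(tc)\<^sup>2/2\<close>; divide by \<open>t\<close>.\<close>

lemma tilted_root_expansion:
  fixes a b c t :: real
  assumes a: "\<bar>a\<bar> \<le> c" and b: "\<bar>b\<bar> \<le> c" and t: "0 < t" "t * c \<le> 1"
  shows "\<bar>(sqrt ((1 + t * a) * (1 + t * b)) - 1) / t - (a + b) / 2\<bar> \<le> 5 * t * c\<^sup>2"
proof -
  have c: "0 \<le> c" using a by linarith
  define s where "s = t * (a + b) + t\<^sup>2 * (a * b)"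
  have prod: "(1 + t * a) * (1 + t * b) = 1 + s"
    by (simp add: s_def power2_eq_square algebra_simps)
  have ta: "\<bar>t * a\<bar> \<le> t * c" "\<bar>t * b\<bar> \<le> t * c" using a b t by (auto simp: abs_mult)
  then have "0 \<le> (1 + t * a) * (1 + t * b)" using t by (intro mult_nonneg_nonneg) auto
  then have s1: "-1 \<le> s" unfolding prod by linarith
  have ab: "\<bar>a * b\<bar> \<le> c\<^sup>2" unfolding abs_mult power2_eq_square using a b c by (intro mult_mono) auto
  have "\<bar>t\<^sup>2 * (a * b)\<bar> = t * (t * \<bar>a * b\<bar>)" using t by (simp add: power2_eq_square abs_mult)
  also have "\<dots> \<le> t * (t * c\<^sup>2)" using ab t by (intro mult_left_mono) auto
  finally have t2: "\<bar>t\<^sup>2 * (a * b)\<bar> \<le> t * (t * c\<^sup>2)" .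
  have tc: "t * (t * c\<^sup>2) \<le> t * c"
    using mult_right_mono[OF t(2), of "t * c"] t c by (simp add: power2_eq_square mult_ac)
  have "\<bar>s\<bar> \<le> 3 * (t * c)"
    unfolding s_def using ta t2 tc by (simp add: distrib_left)
  then have "\<bar>s\<bar>\<^sup>2 \<le> (3 * (t * c))\<^sup>2" by (intro power_mono) auto
  then have s2: "s\<^sup>2 \<le> 9 * (t * (t * c\<^sup>2))" by (simp add: power_mult_distrib power2_eq_square mult_ac)
  let ?x = "sqrt (1 + s) - 1 - s / 2"
  have "(sqrt ((1 + t * a) * (1 + t * b)) - 1) / t - (a + b) / 2 = (?x + t\<^sup>2 * (a * b) / 2) / t"
    unfolding prod using t by (simp add: s_def field_simps)
  moreover have "\<bar>?x + t\<^sup>2 * (a * b) / 2\<bar> \<le> 5 * t * c\<^sup>2 * t"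
  proof -
    have "\<bar>?x + t\<^sup>2 * (a * b) / 2\<bar> \<le> \<bar>?x\<bar> + \<bar>t\<^sup>2 * (a * b)\<bar> / 2"
      using abs_triangle_ineq[of ?x "t\<^sup>2 * (a * b) / 2"] by simp
    also have "\<dots> \<le> 5 * (t * (t * c\<^sup>2))"
      using sqrt_linearization[OF s1] s2 t2 by linarith
    finally show ?thesis by (simp add: mult_ac)
  qed
  ultimately show ?thesis using t by (simp add: divide_le_eq)
qed

lemma eventually_small:
  fixes c :: real assumes "0 < c"
  shows "\<forall>\<^sub>F t in at_right 0. 0 < t \<and> t * c \<le> 1"
  unfolding eventually_at_right_field
  using assms by (intro exI[of _ "1 / c"]) (auto simp: field_simps)

section \<open>Orthogonal sums over a product measure\<close>

locale product =
  fixes \<mu> \<nu> :: "'a::topological_space measure"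
  assumes \<mu>_prob: "\<mu> \<in> space (prob_algebra borel)" and \<nu>_prob: "\<nu> \<in> space (prob_algebra borel)"
begin

lemma prob_mu: "prob_space \<mu>" and sets_mu [measurable_cong]: "sets \<mu> = sets borel"
  using \<mu>_prob by (auto simp: space_prob_algebra)

lemma prob_nu: "prob_space \<nu>" and sets_nu [measurable_cong]: "sets \<nu> = sets borel"
  using \<nu>_prob by (auto simp: space_prob_algebra)

sublocale mu: prob_space \<mu> by (rule prob_mu)
sublocale nu: prob_space \<nu> by (rule prob_nu)
sublocale Q: pair_prob_space \<mu> \<nu> ..

abbreviation Q :: "('a \<times> 'a) measure" where "Q \<equiv> \<mu> \<Otimes>\<^sub>M \<nu>"

lemma finite_Q: "finite_measure Q" by (rule Q.P.finite_measure_axioms)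

lemma product_integral:
  fixes u v :: "'a \<Rightarrow> real"
  assumes u: "integrable \<mu> u" and v: "integrable \<nu> v"
  shows "integrable Q (\<lambda>z. u (fst z) * v (snd z))" (is "integrable Q ?f")
    and "(\<integral>z. u (fst z) * v (snd z) \<partial>Q) = (\<integral>x. u x \<partial>\<mu>) * (\<integral>y. v y \<partial>\<nu>)"
proof -
  have [measurable]: "u \<in> borel_measurable \<mu>" "v \<in> borel_measurable \<nu>" using u v by auto
  show int: "integrable Q ?f"
  proof (rule Q.Fubini_integrable)
    have "integrable \<mu> (\<lambda>x. \<bar>u x\<bar> * (\<integral>y. \<bar>v y\<bar> \<partial>\<nu>))" using u by simp
    then show "integrable \<mu> (\<lambda>x. \<integral>y. norm (u (fst (x, y)) * v (snd (x, y))) \<partial>\<nu>)"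
      by (simp add: abs_mult)
  qed (use v in auto)
  show "(\<integral>z. u (fst z) * v (snd z) \<partial>Q) = (\<integral>x. u x \<partial>\<mu>) * (\<integral>y. v y \<partial>\<nu>)"
    using Q.integral_fst'[OF int] by simp
qed

lemma dsum_eq: "dsum u v = (\<lambda>z. u (fst z) + v (snd z))"
  by (auto simp: dsum_def fun_eq_iff)

text \<open>The mixed terms factor by Fubini and vanish, because each contains the mean of a centred
  function. The two summands of the tangent space are orthogonal, which is why the two variances
  add up.\<close>

lemma dsum_inner:
  assumes "u \<in> L2 \<mu>" "v \<in> L2 \<nu>" "u' \<in> L2 \<mu>" "v' \<in> L2 \<nu>"
    and "(\<integral>x. u x \<partial>\<mu>) = 0" "(\<integral>x. u' x \<partial>\<mu>) = 0"
  shows "integrable Q (\<lambda>z. dsum u v z * dsum u' v' z)"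
    and "(\<integral>z. dsum u v z * dsum u' v' z \<partial>Q) = (\<integral>x. u x * u' x \<partial>\<mu>) + (\<integral>y. v y * v' y \<partial>\<nu>)"
proof -
  have 1: "integrable \<mu> (\<lambda>x. u x * u' x)" "integrable \<nu> (\<lambda>y. v y * v' y)"
    using assms L2_mult_integrable by blast+
  have 2: "integrable \<mu> u" "integrable \<mu> u'" "integrable \<nu> v" "integrable \<nu> v'"
    using assms L2_integrable mu.finite_measure_axioms nu.finite_measure_axioms by blast+
  have one: "integrable \<mu> (\<lambda>x. 1 :: real)" "integrable \<nu> (\<lambda>x. 1 :: real)" by auto
  have eq: "(\<lambda>z. dsum u v z * dsum u' v' z) = (\<lambda>z. u (fst z) * u' (fst z) + u (fst z) * v' (snd z)
      + u' (fst z) * v (snd z) + v (snd z) * v' (snd z))"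
    by (auto simp: dsum_eq algebra_simps)
  have I: "integrable Q (\<lambda>z. u (fst z) * u' (fst z))" "integrable Q (\<lambda>z. u (fst z) * v' (snd z))"
    "integrable Q (\<lambda>z. u' (fst z) * v (snd z))" "integrable Q (\<lambda>z. v (snd z) * v' (snd z))"
    using product_integral(1)[OF 1(1) one(2)] product_integral(1)[OF 2(1,4)]
      product_integral(1)[OF 2(2,3)] product_integral(1)[OF one(1) 1(2)] by simp_all
  have V: "(\<integral>z. u (fst z) * u' (fst z) \<partial>Q) = (\<integral>x. u x * u' x \<partial>\<mu>)"
    "(\<integral>z. u (fst z) * v' (snd z) \<partial>Q) = 0" "(\<integral>z. u' (fst z) * v (snd z) \<partial>Q) = 0"
    "(\<integral>z. v (snd z) * v' (snd z) \<partial>Q) = (\<integral>y. v y * v' y \<partial>\<nu>)"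
    using product_integral(2)[OF 1(1) one(2)] product_integral(2)[OF 2(1,4)]
      product_integral(2)[OF 2(2,3)] product_integral(2)[OF one(1) 1(2)] assms(5,6)
    by (simp_all add: mu.prob_space nu.prob_space)
  show "integrable Q (\<lambda>z. dsum u v z * dsum u' v' z)"
    unfolding eq by (intro Bochner_Integration.integrable_add I)
  show "(\<integral>z. dsum u v z * dsum u' v' z \<partial>Q) = (\<integral>x. u x * u' x \<partial>\<mu>) + (\<integral>y. v y * v' y \<partial>\<nu>)"
    unfolding eq by (simp add: I V)
qed

lemma dsum_measurable:
  "u \<in> borel_measurable borel \<Longrightarrow> v \<in> borel_measurable borel \<Longrightarrow> dsum u v \<in> borel_measurable Q"
  unfolding dsum_eq
  using measurable_cong_sets[OF sets_mu refl] measurable_cong_sets[OF sets_nu refl]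
  by (intro borel_measurable_add measurable_compose[OF measurable_fst] measurable_compose[OF measurable_snd]) auto

lemma dsum_L2:
  assumes "u \<in> L2 \<mu>" "v \<in> L2 \<nu>" "(\<integral>x. u x \<partial>\<mu>) = 0"
  shows "dsum u v \<in> L2 Q"
proof -
  have [measurable]: "u \<in> borel_measurable \<mu>" "v \<in> borel_measurable \<nu>" using assms by (auto simp: L2_def)
  have "dsum u v \<in> borel_measurable Q" unfolding dsum_eq by measurable
  then show ?thesis
    using dsum_inner(1)[OF assms(1,2,1,2,3,3)] by (simp add: L2_def power2_eq_square)
qed

lemma bounded_scores_L2:
  "h \<in> bounded_scores \<mu> \<Longrightarrow> h \<in> L2 \<mu>" "k \<in> bounded_scores \<nu> \<Longrightarrow> k \<in> L2 \<nu>"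
  using L2_bounded[OF mu.finite_measure_axioms] L2_bounded[OF nu.finite_measure_axioms]
    measurable_cong_sets[OF sets_mu refl] measurable_cong_sets[OF sets_nu refl]
  by (fastforce simp: bounded_scores_def)+

lemma product_tangent_L2: "product_tangent \<mu> \<nu> \<subseteq> L2 Q"
  unfolding product_tangent_def
  using bounded_scores_L2 by (auto intro!: dsum_L2) (auto simp: bounded_scores_def)

section \<open>Scores of tilted products\<close>

text \<open>For small \<open>t\<close> the truncation in the definition of the tilted measure is inactive, so the tilted
  product has a bounded density with respect to \<open>Q\<close>. The constant \<open>c\<close> is a common bound for
  \<open>h\<^sub>1\<close> and \<open>h\<^sub>2\<close>, chosen positive so that a small \<open>t\<close> exists.\<close>

lemma tilt_score_defect:
  assumes h: "h1 \<in> bounded_scores \<mu>" "h2 \<in> bounded_scores \<nu>"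
  obtains c where "0 < c"
    "\<And>t g. \<lbrakk>0 < t; t * c \<le> 1; g \<in> borel_measurable Q\<rbrakk> \<Longrightarrow>
      score_defect Q (tilt \<mu> h1 t \<Otimes>\<^sub>M tilt \<nu> h2 t) g t =
      (\<integral>\<^sup>+z. ennreal (((sqrt ((1 + t * h1 (fst z)) * (1 + t * h2 (snd z))) - 1) / t - g z / 2)\<^sup>2) \<partial>Q)"
    "\<And>t z. \<lbrakk>0 < t; t * c \<le> 1\<rbrakk> \<Longrightarrow>
      \<bar>(sqrt ((1 + t * h1 (fst z)) * (1 + t * h2 (snd z))) - 1) / t - dsum h1 h2 z / 2\<bar> \<le> 5 * t * c\<^sup>2"
proof -
  obtain b1 b2 where b: "\<And>x. \<bar>h1 x\<bar> \<le> b1" "\<And>x. \<bar>h2 x\<bar> \<le> b2"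
    and [measurable]: "h1 \<in> borel_measurable borel" "h2 \<in> borel_measurable borel"
    using h by (auto simp: bounded_scores_def)
  define c where "c = max 1 (max b1 b2)"
  have c: "\<bar>h1 x\<bar> \<le> c" "\<bar>h2 x\<bar> \<le> c" for x
    using b[of x] by (auto simp: c_def)
  have small: "\<bar>t * h1 x\<bar> \<le> 1" "\<bar>t * h2 x\<bar> \<le> 1" if "0 < t" "t * c \<le> 1" for t x
  proof -
    have "\<bar>t * h1 x\<bar> \<le> t * c" "\<bar>t * h2 x\<bar> \<le> t * c" using c that by (simp_all add: abs_mult)
    then show "\<bar>t * h1 x\<bar> \<le> 1" "\<bar>t * h2 x\<bar> \<le> 1" using that(2) by linarith+
  qed
  show ?thesis
  proof (rule that[of c])
    show "0 < c" by (simp add: c_def)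
    fix t :: real assume t: "0 < t" "t * c \<le> 1"
    show "\<bar>(sqrt ((1 + t * h1 (fst z)) * (1 + t * h2 (snd z))) - 1) / t - dsum h1 h2 z / 2\<bar> \<le> 5 * t * c\<^sup>2" for z
      using tilted_root_expansion[OF c(1) c(2) t] by (simp add: dsum_eq)
    fix g :: "'a \<times> 'a \<Rightarrow> real" assume g: "g \<in> borel_measurable Q"
    define p where "p z = (1 + t * h1 (fst z)) * (1 + t * h2 (snd z))" for z
    have nn: "0 \<le> 1 + t * h1 x" "0 \<le> 1 + t * h2 x" "1 + t * h1 x \<le> 2" "1 + t * h2 x \<le> 2" for x
      using small[OF t, of x] by auto
    have p0: "0 \<le> p z" for z unfolding p_def using nn by simp
    have p4: "p z \<le> 2 * 2" for z unfolding p_def using nn by (intro mult_mono) auto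
    have pm: "p \<in> borel_measurable Q" unfolding p_def by measurable
    have fin: "finite_measure (tilt \<nu> h2 t)"
    proof (rule finite_measureI)
      have "emeasure (tilt \<nu> h2 t) (space (tilt \<nu> h2 t)) = (\<integral>\<^sup>+y. ennreal (1 + t * h2 y) \<partial>\<nu>)"
        by (simp add: tilt_def emeasure_density cong: nn_integral_cong)
      also have "\<dots> \<le> (\<integral>\<^sup>+y. ennreal 2 \<partial>\<nu>)" using nn by (intro nn_integral_mono ennreal_leI) auto
      finally show "emeasure (tilt \<nu> h2 t) (space (tilt \<nu> h2 t)) \<noteq> \<infinity>"
        by (auto simp: nu.emeasure_space_1 top_unique)
    qed
    have "tilt \<mu> h1 t \<Otimes>\<^sub>M tilt \<nu> h2 t = density Q (\<lambda>(x, y). ennreal (1 + t * h1 x) * ennreal (1 + t * h2 y))"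
      unfolding tilt_def using fin nu.sigma_finite_measure_axioms
      by (intro pair_measure_density) (auto simp: tilt_def finite_measure_def)
    also have "\<dots> = density Q (\<lambda>z. ennreal (p z))"
      using nn by (intro arg_cong[where f="density Q"]) (auto simp: p_def ennreal_mult fun_eq_iff)
    finally show "score_defect Q (tilt \<mu> h1 t \<Otimes>\<^sub>M tilt \<nu> h2 t) g t =
      (\<integral>\<^sup>+z. ennreal (((sqrt ((1 + t * h1 (fst z)) * (1 + t * h2 (snd z))) - 1) / t - g z / 2)\<^sup>2) \<partial>Q)"
      using score_defect_density[OF finite_Q pm p0 p4 g] by (simp add: p_def)
  qed
qed

lemma tilt_has_score:
  assumes h: "h1 \<in> bounded_scores \<mu>" "h2 \<in> bounded_scores \<nu>"
  shows "has_score Q (\<epsilon>, \<lambda>t. tilt \<mu> h1 t \<Otimes>\<^sub>M tilt \<nu> h2 t) (dsum h1 h2)"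
proof -
  obtain c where c: "0 < c"
    "\<And>t g. \<lbrakk>0 < t; t * c \<le> 1; g \<in> borel_measurable Q\<rbrakk> \<Longrightarrow>
      score_defect Q (tilt \<mu> h1 t \<Otimes>\<^sub>M tilt \<nu> h2 t) g t =
      (\<integral>\<^sup>+z. ennreal (((sqrt ((1 + t * h1 (fst z)) * (1 + t * h2 (snd z))) - 1) / t - g z / 2)\<^sup>2) \<partial>Q)"
    "\<And>t z. \<lbrakk>0 < t; t * c \<le> 1\<rbrakk> \<Longrightarrow>
      \<bar>(sqrt ((1 + t * h1 (fst z)) * (1 + t * h2 (snd z))) - 1) / t - dsum h1 h2 z / 2\<bar> \<le> 5 * t * c\<^sup>2"
    using tilt_score_defect[OF h] by blast
  have meas: "dsum h1 h2 \<in> borel_measurable Q"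
    using h by (intro dsum_measurable) (auto simp: bounded_scores_def)
  have "((\<lambda>t. score_defect Q (tilt \<mu> h1 t \<Otimes>\<^sub>M tilt \<nu> h2 t) (dsum h1 h2) t) \<longlongrightarrow> 0) (at_right 0)"
  proof (rule tendsto_sandwich[OF always_eventually _ tendsto_const])
    show "\<forall>t. 0 \<le> score_defect Q (tilt \<mu> h1 t \<Otimes>\<^sub>M tilt \<nu> h2 t) (dsum h1 h2) t" by simp
    show "\<forall>\<^sub>F t in at_right 0. score_defect Q (tilt \<mu> h1 t \<Otimes>\<^sub>M tilt \<nu> h2 t) (dsum h1 h2) t \<le> ennreal ((5 * t * c\<^sup>2)\<^sup>2)"
      using eventually_small[OF c(1)]
    proof eventually_elim
      case (elim t)
      then have t: "0 < t" "t * c \<le> 1" by auto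
      have "score_defect Q (tilt \<mu> h1 t \<Otimes>\<^sub>M tilt \<nu> h2 t) (dsum h1 h2) t
          \<le> (\<integral>\<^sup>+z. ennreal ((5 * t * c\<^sup>2)\<^sup>2) \<partial>Q)"
        unfolding c(2)[OF t meas]
      proof (intro nn_integral_mono ennreal_leI)
        fix z
        show "((sqrt ((1 + t * h1 (fst z)) * (1 + t * h2 (snd z))) - 1) / t - dsum h1 h2 z / 2)\<^sup>2 \<le> (5 * t * c\<^sup>2)\<^sup>2"
          using c(3)[OF t, of z] by (rule abs_le_square_iff[THEN iffD1, OF order_trans]) simp
      qed
      then show ?case by (simp add: Q.P.emeasure_space_1)
    qed
    have "((\<lambda>t. ennreal ((5 * t * c\<^sup>2)\<^sup>2)) \<longlongrightarrow> ennreal ((5 * 0 * c\<^sup>2)\<^sup>2)) (at_right 0)"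
      by (intro tendsto_intros)
    then show "((\<lambda>t. ennreal ((5 * t * c\<^sup>2)\<^sup>2)) \<longlongrightarrow> 0) (at_right 0)" by simp
  qed
  then show ?thesis using meas by (simp add: has_score_def)
qed

text \<open>Two scores of one path, halved, both lie within vanishing \<open>L\<^sup>2(Q)\<close>-distance of the same difference quotients
  of root densities. A path is therefore never paired, except on a null set, with a tangent vector
  other than its own.\<close>

lemma tilt_score_unique:
  assumes h: "h1 \<in> bounded_scores \<mu>" "h2 \<in> bounded_scores \<nu>"
    and g: "has_score Q (\<epsilon>, \<lambda>t. tilt \<mu> h1 t \<Otimes>\<^sub>M tilt \<nu> h2 t) g"
  shows "AE z in Q. g z = dsum h1 h2 z"
proof -
  obtain c where c: "0 < c"
    "\<And>t g. \<lbrakk>0 < t; t * c \<le> 1; g \<in> borel_measurable Q\<rbrakk> \<Longrightarrow>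
      score_defect Q (tilt \<mu> h1 t \<Otimes>\<^sub>M tilt \<nu> h2 t) g t =
      (\<integral>\<^sup>+z. ennreal (((sqrt ((1 + t * h1 (fst z)) * (1 + t * h2 (snd z))) - 1) / t - g z / 2)\<^sup>2) \<partial>Q)"
    "\<And>t z. \<lbrakk>0 < t; t * c \<le> 1\<rbrakk> \<Longrightarrow>
      \<bar>(sqrt ((1 + t * h1 (fst z)) * (1 + t * h2 (snd z))) - 1) / t - dsum h1 h2 z / 2\<bar> \<le> 5 * t * c\<^sup>2"
    using tilt_score_defect[OF h] by blast
  let ?S = "\<lambda>g t. score_defect Q (tilt \<mu> h1 t \<Otimes>\<^sub>M tilt \<nu> h2 t) g t"
  have gm [measurable]: "g \<in> borel_measurable Q" and gl: "((\<lambda>t. ?S g t) \<longlongrightarrow> 0) (at_right 0)"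
    using g by (auto simp: has_score_def)
  have hm [measurable]: "dsum h1 h2 \<in> borel_measurable Q" and hl: "((\<lambda>t. ?S (dsum h1 h2) t) \<longlongrightarrow> 0) (at_right 0)"
    using tilt_has_score[OF h] by (auto simp: has_score_def)
  have [measurable]: "h1 \<in> borel_measurable borel" "h2 \<in> borel_measurable borel"
    using h by (auto simp: bounded_scores_def)
  let ?I = "\<integral>\<^sup>+z. ennreal (((g z - dsum h1 h2 z) / 2)\<^sup>2) \<partial>Q"
  have "?I \<le> 2 * 0 + 2 * 0"
  proof (rule tendsto_lowerbound)
    show "((\<lambda>t. 2 * ?S g t + 2 * ?S (dsum h1 h2) t) \<longlongrightarrow> 2 * 0 + 2 * 0) (at_right 0)"
      by (intro tendsto_add ennreal_tendsto_cmult gl hl) auto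
    show "\<forall>\<^sub>F t in at_right 0. ?I \<le> 2 * ?S g t + 2 * ?S (dsum h1 h2) t"
      using eventually_small[OF c(1)]
    proof eventually_elim
      case (elim t)
      then have t: "0 < t" "t * c \<le> 1" by auto
      define r where "r z = (sqrt ((1 + t * h1 (fst z)) * (1 + t * h2 (snd z))) - 1) / t" for z
      have [measurable]: "r \<in> borel_measurable Q" unfolding r_def by measurable
      \<comment> \<open>triangle inequality through the common difference quotient \<open>r\<close>\<close>
      have "?I \<le> (\<integral>\<^sup>+z. 2 * ennreal ((r z - g z / 2)\<^sup>2) + 2 * ennreal ((r z - dsum h1 h2 z / 2)\<^sup>2) \<partial>Q)"
      proof (rule nn_integral_mono)
        fix z
        have "((a - b) / 2)\<^sup>2 \<le> 2 * (x - a / 2)\<^sup>2 + 2 * (x - b / 2)\<^sup>2" for a b x :: real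
        proof -
          have "2 * (x - a / 2)\<^sup>2 + 2 * (x - b / 2)\<^sup>2 - ((a - b) / 2)\<^sup>2 = (2 * x - (a + b) / 2)\<^sup>2"
            by (simp add: power2_eq_square field_simps)
          then show ?thesis by (metis diff_ge_0_iff_ge zero_le_power2)
        qed
        then have "ennreal (((g z - dsum h1 h2 z) / 2)\<^sup>2)
            \<le> ennreal (2 * (r z - g z / 2)\<^sup>2 + 2 * (r z - dsum h1 h2 z / 2)\<^sup>2)"
          by (intro ennreal_leI)
        then show "ennreal (((g z - dsum h1 h2 z) / 2)\<^sup>2)
            \<le> 2 * ennreal ((r z - g z / 2)\<^sup>2) + 2 * ennreal ((r z - dsum h1 h2 z / 2)\<^sup>2)"
          by (simp add: ennreal_plus ennreal_mult)
      qed
      also have "\<dots> = 2 * ?S g t + 2 * ?S (dsum h1 h2) t"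
        unfolding c(2)[OF t gm] c(2)[OF t hm] r_def[symmetric]
        by (simp add: nn_integral_add nn_integral_cmult)
      finally show ?case .
    qed
  qed simp
  then have "?I = 0" by simp
  then have "AE z in Q. ennreal (((g z - dsum h1 h2 z) / 2)\<^sup>2) = 0"
    by (subst (asm) nn_integral_0_iff_AE) auto
  then show ?thesis by eventually_elim simp
qed

section \<open>The tangent space and the efficiency bound\<close>

lemma product_tangent_combination:
  assumes "g \<in> product_tangent \<mu> \<nu>" "h \<in> product_tangent \<mu> \<nu>"
  shows "(\<lambda>z. a * g z + b * h z) \<in> product_tangent \<mu> \<nu>"
proof -
  have comb: "(\<lambda>x. a * u x + b * v x) \<in> bounded_scores \<rho>"
    if "\<rho> \<in> space (prob_algebra borel)" and u: "u \<in> bounded_scores \<rho>" and v: "v \<in> bounded_scores \<rho>"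
    for u v and \<rho> :: "'a measure"
  proof -
    obtain B C where B: "\<And>x. \<bar>u x\<bar> \<le> B" and C: "\<And>x. \<bar>v x\<bar> \<le> C"
      and m [measurable]: "u \<in> borel_measurable borel" "v \<in> borel_measurable borel"
      and 0: "(\<integral>x. u x \<partial>\<rho>) = 0" "(\<integral>x. v x \<partial>\<rho>) = 0"
      using u v by (auto simp: bounded_scores_def)
    have \<rho>: "finite_measure \<rho>" "sets \<rho> = sets borel"
      using that(1) by (auto simp: space_prob_algebra prob_space_def)
    have m': "u \<in> borel_measurable \<rho>" "v \<in> borel_measurable \<rho>"
      using m measurable_cong_sets[OF \<rho>(2) refl] by blast+
    have "u \<in> L2 \<rho>" "v \<in> L2 \<rho>"
      by (rule L2_bounded[OF \<rho>(1) m'(1) B], rule L2_bounded[OF \<rho>(1) m'(2) C])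
    then have "integrable \<rho> u" "integrable \<rho> v" using L2_integrable[OF \<rho>(1)] by auto
    then have "(\<integral>x. a * u x + b * v x \<partial>\<rho>) = 0" using 0 by simp
    moreover have "\<bar>a * u x + b * v x\<bar> \<le> \<bar>a\<bar> * B + \<bar>b\<bar> * C" for x
    proof -
      have "\<bar>a * u x + b * v x\<bar> \<le> \<bar>a\<bar> * \<bar>u x\<bar> + \<bar>b\<bar> * \<bar>v x\<bar>"
        by (metis abs_mult abs_triangle_ineq)
      also have "\<dots> \<le> \<bar>a\<bar> * B + \<bar>b\<bar> * C"
        using B C by (intro add_mono mult_left_mono) auto
      finally show ?thesis .
    qed
    ultimately show ?thesis by (auto simp: bounded_scores_def)
  qed
  obtain g1 g2 h1 h2 where gh: "g = dsum g1 g2" "h = dsum h1 h2"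
    "g1 \<in> bounded_scores \<mu>" "g2 \<in> bounded_scores \<nu>" "h1 \<in> bounded_scores \<mu>" "h2 \<in> bounded_scores \<nu>"
    using assms unfolding product_tangent_def by blast
  have "(\<lambda>z. a * g z + b * h z) = dsum (\<lambda>x. a * g1 x + b * h1 x) (\<lambda>x. a * g2 x + b * h2 x)"
    unfolding gh dsum_eq by (auto simp: algebra_simps)
  then show ?thesis
    using comb[OF \<mu>_prob gh(3,5)] comb[OF \<nu>_prob gh(4,6)] unfolding product_tangent_def by blast
qed

lemma product_tangent_zero: "(\<lambda>_. 0) \<in> product_tangent \<mu> \<nu>"
proof -
  have "(\<lambda>_. 0) = dsum (\<lambda>_. 0) (\<lambda>_. 0 :: real)" by (auto simp: dsum_eq)
  moreover have "(\<lambda>_. 0) \<in> bounded_scores \<rho>" for \<rho> :: "'a measure" by (auto simp: bounded_scores_def)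
  ultimately show ?thesis unfolding product_tangent_def by blast
qed

lemma lin_product_tangent: "lin (product_tangent \<mu> \<nu>) = product_tangent \<mu> \<nu>"
proof
  have "(\<lambda>z. \<Sum>g\<in>A. c g * g z) \<in> product_tangent \<mu> \<nu>"
    if "finite A" "A \<subseteq> product_tangent \<mu> \<nu>" for A c
    using that
  proof induction
    case (insert g A)
    then show ?case
      using product_tangent_combination[of g "\<lambda>z. \<Sum>g\<in>A. c g * g z" "c g" 1] by simp
  qed (simp add: product_tangent_zero)
  then show "lin (product_tangent \<mu> \<nu>) \<subseteq> product_tangent \<mu> \<nu>"
    unfolding lin_def by blast
  show "product_tangent \<mu> \<nu> \<subseteq> lin (product_tangent \<mu> \<nu>)"
  proof
    fix g assume "g \<in> product_tangent \<mu> \<nu>"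
    then show "g \<in> lin (product_tangent \<mu> \<nu>)"
      unfolding lin_def by (auto intro!: exI[of _ "{g}"] exI[of _ "\<lambda>_. 1"])
  qed
qed

text \<open>The supremum of \<open>\<langle>h, \<Phi>\<rangle>\<^sup>2 / \<parallel>h\<parallel>\<^sup>2\<close> with \<open>\<Phi> = \<phi> \<oplus> \<psi>\<close> is at most
  \<open>\<parallel>\<Phi>\<parallel>\<^sup>2\<close> by the Cauchy-Schwarz inequality, and it is approached along bounded
  scores converging to \<open>\<Phi>\<close>.\<close>

lemma efficiency_bound_eq:
  assumes \<phi>: "\<phi> \<in> L2 \<mu>" "(\<integral>x. \<phi> x \<partial>\<mu>) = 0" and \<psi>: "\<psi> \<in> L2 \<nu>" "(\<integral>y. \<psi> y \<partial>\<nu>) = 0"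
    and \<Lambda>: "\<And>h. h \<in> product_tangent \<mu> \<nu> \<Longrightarrow> \<Lambda> h = (\<integral>z. h z * dsum \<phi> \<psi> z \<partial>Q)"
  shows "efficiency_bound Q (product_tangent \<mu> \<nu>) \<Lambda> = ennreal ((\<integral>x. (\<phi> x)\<^sup>2 \<partial>\<mu>) + (\<integral>y. (\<psi> y)\<^sup>2 \<partial>\<nu>))"
proof -
  let ?T = "product_tangent \<mu> \<nu>" and ?\<Phi> = "dsum \<phi> \<psi>"
  define V where "V = (\<integral>z. (?\<Phi> z)\<^sup>2 \<partial>Q)"
  have V: "V = (\<integral>x. (\<phi> x)\<^sup>2 \<partial>\<mu>) + (\<integral>y. (\<psi> y)\<^sup>2 \<partial>\<nu>)"
    using dsum_inner(2)[OF \<phi>(1) \<psi>(1) \<phi>(1) \<psi>(1) \<phi>(2) \<phi>(2)] by (simp add: V_def power2_eq_square)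
  have \<Phi>: "?\<Phi> \<in> L2 Q" using dsum_L2[OF \<phi>(1) \<psi>(1) \<phi>(2)] .
  have V0: "0 \<le> V" by (simp add: V_def)
  have norm_sq: "(L2_norm Q h)\<^sup>2 = (\<integral>z. (h z)\<^sup>2 \<partial>Q)" for h by (simp add: L2_norm_def)
  have upper: "efficiency_bound Q ?T \<Lambda> \<le> ennreal V"
    unfolding efficiency_bound_def lin_product_tangent
  proof (intro SUP_least ennreal_leI)
    fix h assume h: "h \<in> {h \<in> ?T. L2_norm Q h \<noteq> 0}"
    then have "\<bar>\<Lambda> h\<bar> \<le> L2_norm Q h * L2_norm Q ?\<Phi>"
      using L2_Cauchy_Schwarz[OF _ \<Phi>] product_tangent_L2 \<Lambda> by auto
    then have "\<bar>\<Lambda> h\<bar>\<^sup>2 \<le> (L2_norm Q h * L2_norm Q ?\<Phi>)\<^sup>2" by (intro power_mono) auto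
    then have "(\<Lambda> h)\<^sup>2 \<le> (L2_norm Q h)\<^sup>2 * V"
      by (simp add: power_mult_distrib norm_sq[of ?\<Phi>] V_def)
    moreover have "0 < (L2_norm Q h)\<^sup>2" using h by auto
    ultimately show "(\<Lambda> h)\<^sup>2 / (L2_norm Q h)\<^sup>2 \<le> V" by (simp add: divide_le_eq mult.commute)
  qed
  have lower: "ennreal V \<le> efficiency_bound Q ?T \<Lambda>"
  proof (cases "V = 0")
    case False
    then have Vpos: "0 < V" using V0 by linarith
    obtain f where f: "\<And>n. f n \<in> bounded_scores \<mu>" "(\<lambda>n. \<integral>x. (f n x - \<phi> x)\<^sup>2 \<partial>\<mu>) \<longlonglongrightarrow> 0"
      using bounded_scores_dense[OF \<mu>_prob \<phi>] by blast
    obtain g where g: "\<And>n. g n \<in> bounded_scores \<nu>" "(\<lambda>n. \<integral>y. (g n y - \<psi> y)\<^sup>2 \<partial>\<nu>) \<longlonglongrightarrow> 0"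
      using bounded_scores_dense[OF \<nu>_prob \<psi>] by blast
    define h where "h n = dsum (f n) (g n)" for n
    have hT: "h n \<in> ?T" for n unfolding h_def product_tangent_def using f(1) g(1) by blast
    have hL: "h n \<in> L2 Q" for n using hT product_tangent_L2 by blast
    have dist: "(\<integral>z. (h n z - ?\<Phi> z)\<^sup>2 \<partial>Q) = (\<integral>x. (f n x - \<phi> x)\<^sup>2 \<partial>\<mu>) + (\<integral>y. (g n y - \<psi> y)\<^sup>2 \<partial>\<nu>)" for n
    proof -
      have eq: "(\<lambda>z. h n z - ?\<Phi> z) = dsum (\<lambda>x. f n x - \<phi> x) (\<lambda>y. g n y - \<psi> y)"
        by (auto simp: h_def dsum_eq)
      have L: "(\<lambda>x. f n x - \<phi> x) \<in> L2 \<mu>" "(\<lambda>y. g n y - \<psi> y) \<in> L2 \<nu>"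
        using L2_diff bounded_scores_L2 f(1) g(1) \<phi>(1) \<psi>(1) by blast+
      have "integrable \<mu> (f n)" "integrable \<mu> \<phi>"
        using L2_integrable[OF mu.finite_measure_axioms] bounded_scores_L2(1) f(1) \<phi>(1) by blast+
      then have "(\<integral>x. f n x - \<phi> x \<partial>\<mu>) = 0" using f(1)[of n] \<phi>(2) by (simp add: bounded_scores_def)
      from dsum_inner(2)[OF L L this this] show ?thesis
        unfolding eq[THEN fun_cong] by (simp add: power2_eq_square)
    qed
    have lim: "(\<lambda>n. \<integral>z. (h n z - ?\<Phi> z)\<^sup>2 \<partial>Q) \<longlonglongrightarrow> 0"
      unfolding dist using tendsto_add[OF f(2) g(2)] by simp
    have l1: "(\<lambda>n. \<Lambda> (h n)) \<longlonglongrightarrow> V"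
      using L2_tendsto_inner[OF hL \<Phi> \<Phi> lim] by (simp add: \<Lambda>[OF hT] V_def power2_eq_square)
    have l2: "(\<lambda>n. (L2_norm Q (h n))\<^sup>2) \<longlonglongrightarrow> V"
      unfolding norm_sq V_def by (rule L2_tendsto_square[OF hL \<Phi> lim])
    have "(\<lambda>n. (\<Lambda> (h n))\<^sup>2 / (L2_norm Q (h n))\<^sup>2) \<longlonglongrightarrow> V\<^sup>2 / V"
      by (intro tendsto_intros l1 l2 False)
    then have l3: "(\<lambda>n. ennreal ((\<Lambda> (h n))\<^sup>2 / (L2_norm Q (h n))\<^sup>2)) \<longlonglongrightarrow> ennreal V"
      using Vpos by (intro tendsto_ennrealI) (simp add: power2_eq_square)
    show ?thesis
    proof (rule tendsto_upperbound[OF l3])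
      show "\<forall>\<^sub>F n in sequentially. ennreal ((\<Lambda> (h n))\<^sup>2 / (L2_norm Q (h n))\<^sup>2) \<le> efficiency_bound Q ?T \<Lambda>"
        using order_tendstoD(1)[OF l2 Vpos]
      proof eventually_elim
        case (elim n)
        then show ?case
          unfolding efficiency_bound_def lin_product_tangent
          by (intro SUP_upper) (use hT in auto)
      qed
    qed simp
  qed simp
  show ?thesis using upper lower by (simp add: V antisym)
qed

lemma tangent_space_product:
  assumes P: "\<And>h1 h2. h1 \<in> bounded_scores \<mu> \<Longrightarrow> h2 \<in> bounded_scores \<nu> \<Longrightarrow>
           \<forall>\<^sub>F t in at_right 0. tilt \<mu> h1 t \<Otimes>\<^sub>M tilt \<nu> h2 t \<in> P"
    and Q: "Q \<in> P"
  shows "tangent_space P Q (tilt_submodels P \<mu> \<nu>) (product_tangent \<mu> \<nu>)"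
    and "\<And>h1 h2. h1 \<in> bounded_scores \<mu> \<Longrightarrow> h2 \<in> bounded_scores \<nu> \<Longrightarrow>
      \<exists>\<epsilon>. (\<epsilon>, \<lambda>t. tilt \<mu> h1 t \<Otimes>\<^sub>M tilt \<nu> h2 t) \<in> tilt_submodels P \<mu> \<nu>"
proof -
  have Q0: "tilt \<mu> h1 0 \<Otimes>\<^sub>M tilt \<nu> h2 0 = Q" for h1 h2
    by (simp add: tilt_def density_1)
  show ex: "\<exists>\<epsilon>. (\<epsilon>, \<lambda>t. tilt \<mu> h1 t \<Otimes>\<^sub>M tilt \<nu> h2 t) \<in> tilt_submodels P \<mu> \<nu>"
    if h: "h1 \<in> bounded_scores \<mu>" "h2 \<in> bounded_scores \<nu>" for h1 h2
  proof -
    obtain \<epsilon> where \<epsilon>: "0 < \<epsilon>" "\<And>t. 0 < t \<Longrightarrow> t < \<epsilon> \<Longrightarrow> tilt \<mu> h1 t \<Otimes>\<^sub>M tilt \<nu> h2 t \<in> P"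
      using P[OF h] unfolding eventually_at_right_field by blast
    have "tilt \<mu> h1 t \<Otimes>\<^sub>M tilt \<nu> h2 t \<in> P" if "t \<in> {0..<\<epsilon>}" for t
      using that \<epsilon>(2)[of t] Q Q0 by (cases "t = 0") auto
    then have "submodel P Q (\<epsilon>, \<lambda>t. tilt \<mu> h1 t \<Otimes>\<^sub>M tilt \<nu> h2 t)"
      using \<epsilon>(1) Q0 by (simp add: submodel_def)
    then show ?thesis using h unfolding tilt_submodels_def by blast
  qed
  have "tangent_set P Q (tilt_submodels P \<mu> \<nu>) (product_tangent \<mu> \<nu>)"
    unfolding tangent_set_def
  proof (intro conjI ballI)
    fix s assume s: "s \<in> tilt_submodels P \<mu> \<nu>"
    then show "submodel P Q s" by (simp add: tilt_submodels_def)
    obtain \<epsilon> h1 h2 where h: "h1 \<in> bounded_scores \<mu>" "h2 \<in> bounded_scores \<nu>"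
      "s = (\<epsilon>, \<lambda>t. tilt \<mu> h1 t \<Otimes>\<^sub>M tilt \<nu> h2 t)"
      using s unfolding tilt_submodels_def by blast
    then show "\<exists>h\<in>product_tangent \<mu> \<nu>. has_score Q s h"
      using tilt_has_score[OF h(1,2)] unfolding product_tangent_def by blast
  next
    fix h assume "h \<in> product_tangent \<mu> \<nu>"
    then obtain h1 h2 where h: "h1 \<in> bounded_scores \<mu>" "h2 \<in> bounded_scores \<nu>" "h = dsum h1 h2"
      unfolding product_tangent_def by blast
    then show "\<exists>s\<in>tilt_submodels P \<mu> \<nu>. has_score Q s h"
      using ex[OF h(1,2)] tilt_has_score[OF h(1,2)] by blast
  qed
  then show "tangent_space P Q (tilt_submodels P \<mu> \<nu>) (product_tangent \<mu> \<nu>)"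
    unfolding tangent_space_def using product_tangent_L2 product_tangent_zero product_tangent_combination by blast
qed

text \<open>The gradient is \<open>\<Phi> = \<phi> \<oplus> \<psi>\<close>. On the tangent space every derivative agrees with the
  inner product with \<open>\<Phi>\<close>, since each tangent vector is the score of some tilt and limits are
  unique; the values outside the tangent space remain free.\<close>

lemma pathwise_derivative:
  assumes P: "\<And>h1 h2. h1 \<in> bounded_scores \<mu> \<Longrightarrow> h2 \<in> bounded_scores \<nu> \<Longrightarrow>
           \<forall>\<^sub>F t in at_right 0. tilt \<mu> h1 t \<Otimes>\<^sub>M tilt \<nu> h2 t \<in> P"
    and Q: "Q \<in> P"
    and \<phi>: "\<phi> \<in> L2 \<mu>" "(\<integral>x. \<phi> x \<partial>\<mu>) = 0" and \<psi>: "\<psi> \<in> L2 \<nu>"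
    and deriv: "\<And>h1 h2. h1 \<in> bounded_scores \<mu> \<Longrightarrow> h2 \<in> bounded_scores \<nu> \<Longrightarrow>
       ((\<lambda>t. (\<kappa> (tilt \<mu> h1 t \<Otimes>\<^sub>M tilt \<nu> h2 t) - \<kappa> Q) / t)
          \<longlongrightarrow> (\<integral>x. \<phi> x * h1 x \<partial>\<mu>) + (\<integral>y. \<psi> y * h2 y \<partial>\<nu>)) (at_right 0)"
  defines "\<C> \<equiv> tilt_submodels P \<mu> \<nu>" and "T \<equiv> product_tangent \<mu> \<nu>"
  shows "has_pathwise_derivative \<kappa> Q \<C> T (\<lambda>h. \<integral>z. h z * dsum \<phi> \<psi> z \<partial>Q)"
    and "has_pathwise_derivative \<kappa> Q \<C> T \<Lambda> \<Longrightarrow> h \<in> T \<Longrightarrow> \<Lambda> h = (\<integral>z. h z * dsum \<phi> \<psi> z \<partial>Q)"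
proof -
  have \<Phi>: "dsum \<phi> \<psi> \<in> L2 Q" using dsum_L2[OF \<phi>(1) \<psi> \<phi>(2)] .
  have inner: "(\<integral>z. dsum h1 h2 z * dsum \<phi> \<psi> z \<partial>Q) = (\<integral>x. \<phi> x * h1 x \<partial>\<mu>) + (\<integral>y. \<psi> y * h2 y \<partial>\<nu>)"
    if "h1 \<in> bounded_scores \<mu>" "h2 \<in> bounded_scores \<nu>" for h1 h2
    using dsum_inner(2)[OF bounded_scores_L2(1)[OF that(1)] bounded_scores_L2(2)[OF that(2)] \<phi>(1) \<psi> _ \<phi>(2)] that
    by (simp add: bounded_scores_def mult.commute)
  have path: "((\<lambda>t. (\<kappa> (Qt t) - \<kappa> Q) / t) \<longlongrightarrow> (\<integral>z. h z * dsum \<phi> \<psi> z \<partial>Q)) (at_right 0)"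
    if h: "h \<in> T" and s: "(\<epsilon>, Qt) \<in> \<C>" and score: "has_score Q (\<epsilon>, Qt) h" for h \<epsilon> Qt
  proof -
    obtain h1 h2 where h12: "h1 \<in> bounded_scores \<mu>" "h2 \<in> bounded_scores \<nu>"
      "Qt = (\<lambda>t. tilt \<mu> h1 t \<Otimes>\<^sub>M tilt \<nu> h2 t)"
      using s unfolding \<C>_def tilt_submodels_def by blast
    have AE: "AE z in Q. h z = dsum h1 h2 z"
      using tilt_score_unique[OF h12(1,2)] score h12(3) by blast
    have m: "h \<in> borel_measurable Q" "dsum \<phi> \<psi> \<in> borel_measurable Q"
      using h product_tangent_L2 \<Phi> by (auto simp: T_def L2_def)
    moreover have "dsum h1 h2 \<in> borel_measurable Q"
      using h12 by (intro dsum_measurable) (auto simp: bounded_scores_def)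
    ultimately have "(\<integral>z. h z * dsum \<phi> \<psi> z \<partial>Q) = (\<integral>z. dsum h1 h2 z * dsum \<phi> \<psi> z \<partial>Q)"
      using AE by (intro integral_cong_AE) auto
    then show ?thesis using deriv[OF h12(1,2)] inner[OF h12(1,2)] h12(3) by simp
  qed
  show "has_pathwise_derivative \<kappa> Q \<C> T (\<lambda>h. \<integral>z. h z * dsum \<phi> \<psi> z \<partial>Q)"
    unfolding has_pathwise_derivative_def using inner_L2_dual[OF \<Phi>] path by blast
  show "\<Lambda> h = (\<integral>z. h z * dsum \<phi> \<psi> z \<partial>Q)"
    if \<Lambda>: "has_pathwise_derivative \<kappa> Q \<C> T \<Lambda>" and h: "h \<in> T"
  proof -
    have "tangent_set P Q \<C> T"
      using tangent_space_product(1)[OF P Q] by (simp add: \<C>_def T_def tangent_space_def)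
    then obtain \<epsilon> Qt where s: "(\<epsilon>, Qt) \<in> \<C>" "has_score Q (\<epsilon>, Qt) h"
      using h unfolding tangent_set_def by (metis surj_pair)
    have "((\<lambda>t. (\<kappa> (Qt t) - \<kappa> Q) / t) \<longlongrightarrow> \<Lambda> h) (at_right 0)"
      using \<Lambda> h s unfolding has_pathwise_derivative_def by blast
    then show ?thesis using path[OF h s] tendsto_unique[OF trivial_limit_at_right_real] by blast
  qed
qed

end

section \<open>The efficiency bound as a sum of variances\<close>

theorem corollary2:
  fixes F :: "('a::topological_space \<Rightarrow> real) set"
    and E :: "'a \<Rightarrow> real"
    and \<mu> \<nu> :: "'a measure"
    and P\<mu> P\<nu> :: "'a measure set"
    and \<delta> :: "('a \<times> 'a) measure \<Rightarrow> real"
    and \<delta>\<mu> \<delta>\<nu> :: "(('a \<Rightarrow> real) \<Rightarrow> real) \<Rightarrow> real"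
    and M\<mu> :: "'u measure" and G\<mu> :: "'u \<Rightarrow> ('a \<Rightarrow> real) \<Rightarrow> real"
    and M\<nu> :: "'v measure" and G\<nu> :: "'v \<Rightarrow> ('a \<Rightarrow> real) \<Rightarrow> real"
  assumes "F \<subseteq> borel_measurable borel"
    and "envelope E F"
    and "P\<mu> \<subseteq> space (prob_algebra borel)" and "P\<nu> \<subseteq> space (prob_algebra borel)"
    and "\<mu> \<in> P\<mu>" and "\<nu> \<in> P\<nu>"
    and "\<And>\<rho>. \<rho> \<in> P\<mu> \<union> P\<nu> \<Longrightarrow> integrable \<rho> E"
    and "pre_gaussian F \<mu>" and "pre_gaussian F \<nu>"
    and "\<And>h1 h2. h1 \<in> bounded_scores \<mu> \<Longrightarrow> h2 \<in> bounded_scores \<nu> \<Longrightarrow>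
           \<forall>\<^sub>F t in at_right 0. tilt \<mu> h1 t \<Otimes>\<^sub>M tilt \<nu> h2 t \<in> product_model P\<mu> P\<nu>"
    and "linf_dual F \<delta>\<mu>" and "linf_dual F \<delta>\<nu>"
    and "\<And>h1 h2. h1 \<in> bounded_scores \<mu> \<Longrightarrow> h2 \<in> bounded_scores \<nu> \<Longrightarrow>
           ((\<lambda>t. (\<delta> (tilt \<mu> h1 t \<Otimes>\<^sub>M tilt \<nu> h2 t) - \<delta> (\<mu> \<Otimes>\<^sub>M \<nu>)) / t)
              \<longlongrightarrow> \<delta>\<mu> (weighted F h1 \<mu>) + \<delta>\<nu> (weighted F h2 \<nu>)) (at_right 0)"
    and "brownian_bridge F \<mu> M\<mu> G\<mu>" and "brownian_bridge F \<nu> M\<nu> G\<nu>"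
  shows "let Q = \<mu> \<Otimes>\<^sub>M \<nu>;
             P = product_model P\<mu> P\<nu>;
             \<C> = tilt_submodels P \<mu> \<nu>;
             T = product_tangent \<mu> \<nu>
         in tangent_space P Q \<C> T \<and>
            (\<exists>\<Lambda>. has_pathwise_derivative \<delta> Q \<C> T \<Lambda>) \<and>
            (\<forall>\<Lambda>. has_pathwise_derivative \<delta> Q \<C> T \<Lambda> \<longrightarrow>
               efficiency_bound Q T \<Lambda> =
                 ennreal (prob_space.variance M\<mu> (\<lambda>w. \<delta>\<mu> (G\<mu> w)) +
                          prob_space.variance M\<nu> (\<lambda>w. \<delta>\<nu> (G\<nu> w))))"
proof -
  note F = assms(1) and env = assms(2) and P\<mu> = assms(3) and P\<nu> = assms(4)
    and \<mu> = assms(5) and \<nu> = assms(6) and int_E = assms(7) and tilts = assms(10)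
    and dual\<mu> = assms(11) and dual\<nu> = assms(12) and deriv = assms(13)
    and bridge\<mu> = assms(14) and bridge\<nu> = assms(15)
  have prob: "\<mu> \<in> space (prob_algebra borel)" "\<nu> \<in> space (prob_algebra borel)"
    using P\<mu> P\<nu> \<mu> \<nu> by auto
  interpret product \<mu> \<nu> by unfold_locales (rule prob)+
  interpret B\<mu>: bridge F \<mu> M\<mu> G\<mu> by unfold_locales (rule F prob bridge\<mu>)+
  interpret B\<nu>: bridge F \<nu> M\<nu> G\<nu> by unfold_locales (rule F prob bridge\<nu>)+
  obtain \<phi> where \<phi>: "\<phi> \<in> L2 \<mu>" "(\<integral>x. \<phi> x \<partial>\<mu>) = 0"
    "(\<integral>x. (\<phi> x)\<^sup>2 \<partial>\<mu>) = prob_space.variance M\<mu> (\<lambda>w. \<delta>\<mu> (G\<mu> w))"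
    "\<And>h. h \<in> bounded_scores \<mu> \<Longrightarrow> (\<integral>x. \<phi> x * h x \<partial>\<mu>) = \<delta>\<mu> (weighted F h \<mu>)"
    using B\<mu>.influence_function[OF dual\<mu> env int_E] \<mu> by blast
  obtain \<psi> where \<psi>: "\<psi> \<in> L2 \<nu>" "(\<integral>y. \<psi> y \<partial>\<nu>) = 0"
    "(\<integral>y. (\<psi> y)\<^sup>2 \<partial>\<nu>) = prob_space.variance M\<nu> (\<lambda>w. \<delta>\<nu> (G\<nu> w))"
    "\<And>h. h \<in> bounded_scores \<nu> \<Longrightarrow> (\<integral>y. \<psi> y * h y \<partial>\<nu>) = \<delta>\<nu> (weighted F h \<nu>)"
    using B\<nu>.influence_function[OF dual\<nu> env int_E] \<nu> by blast
  let ?P = "product_model P\<mu> P\<nu>"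
  have Q_P: "\<mu> \<Otimes>\<^sub>M \<nu> \<in> ?P" using \<mu> \<nu> by (auto simp: product_model_def)
  have deriv': "((\<lambda>t. (\<delta> (tilt \<mu> h1 t \<Otimes>\<^sub>M tilt \<nu> h2 t) - \<delta> (\<mu> \<Otimes>\<^sub>M \<nu>)) / t)
      \<longlongrightarrow> (\<integral>x. \<phi> x * h1 x \<partial>\<mu>) + (\<integral>y. \<psi> y * h2 y \<partial>\<nu>)) (at_right 0)"
    if "h1 \<in> bounded_scores \<mu>" "h2 \<in> bounded_scores \<nu>" for h1 h2
    using deriv[OF that] \<phi>(4)[OF that(1)] \<psi>(4)[OF that(2)] by simp
  show ?thesis
    unfolding Let_def
  proof (intro conjI allI impI)
    show "tangent_space ?P (\<mu> \<Otimes>\<^sub>M \<nu>) (tilt_submodels ?P \<mu> \<nu>) (product_tangent \<mu> \<nu>)"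
      by (rule tangent_space_product(1)[OF tilts Q_P])
    show "\<exists>\<Lambda>. has_pathwise_derivative \<delta> (\<mu> \<Otimes>\<^sub>M \<nu>) (tilt_submodels ?P \<mu> \<nu>) (product_tangent \<mu> \<nu>) \<Lambda>"
      by (rule exI, rule pathwise_derivative(1)[OF tilts Q_P \<phi>(1,2) \<psi>(1) deriv'])
    fix \<Lambda>
    assume \<Lambda>: "has_pathwise_derivative \<delta> (\<mu> \<Otimes>\<^sub>M \<nu>) (tilt_submodels ?P \<mu> \<nu>) (product_tangent \<mu> \<nu>) \<Lambda>"
    have "\<Lambda> h = (\<integral>z. h z * dsum \<phi> \<psi> z \<partial>(\<mu> \<Otimes>\<^sub>M \<nu>))" if "h \<in> product_tangent \<mu> \<nu>" for h
      by (rule pathwise_derivative(2)[OF tilts Q_P \<phi>(1,2) \<psi>(1) deriv']) (use \<Lambda> that in simp_all)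
    from efficiency_bound_eq[OF \<phi>(1,2) \<psi>(1,2) this]
    show "efficiency_bound (\<mu> \<Otimes>\<^sub>M \<nu>) (product_tangent \<mu> \<nu>) \<Lambda> =
        ennreal (prob_space.variance M\<mu> (\<lambda>w. \<delta>\<mu> (G\<mu> w)) + prob_space.variance M\<nu> (\<lambda>w. \<delta>\<nu> (G\<nu> w)))"
      unfolding \<phi>(3) \<psi>(3) .
  qed
qed

end
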